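(* Let $\sigma>0$, let $\mu$ be the isotropic Gaussian distribution $\mathcal N(0,\sigma^2 I)$ on $\mathbb R^d$, let $f\in\mathcal F$, $g=f\star\mu$, $x\in\mathbb R^d$, $y^{(0)}=g(x)_c$ and $y^{(1)}=\nabla g_c(x)$. Then the certified safety region $\mathbf{SR}_L(x)$ calculated using the zeroth- and first-order local information is convex, i.e. if $x_1,x_2\in\mathbf{SR}_L(x)$ then $\frac{x_1+x_2}{2}\in\mathbf{SR}_L(x)$.
   Context: $\mathcal Y$ is a finite set of at least two classes, $\Delta^{\mathcal Y}$ the probability simplex over $\mathcal Y$, $\mathcal F$ the set of all measurable $f:\mathbb R^d\to\Delta^{\mathcal Y}$. $(f\star\mu)(x)=\int_{\mathbb R^d}f(x+z)\mu(z)\,dz$ and $\mathcal G^\mu_{\mathcal F}=\{f\star\mu:f\in\mathcal F\}$. A class $c\in\mathcal Y$ (the class predicted at $x$) is fixed, $h(z)_c$ denotes the $c$-th component of $h(z)$ and $h_c$ the corresponding scalar function. The first-order lower-bound probability function is $$\mathbf p_x(z)=\min\{h(z)_c:\ h\in\mathcal G^\mu_{\mathcal F},\ h(x)_c=y^{(0)},\ \nabla h_c(x)=y^{(1)}\},$$ and the first-order certified safety region is $\mathbf{SR}_L(x)=\{\delta\in\mathbb R^d:\ \mathbf p_x(x+\delta)>\tfrac12\}$. *)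

theory Defs
  imports "HOL-Analysis.Analysis"
begin

text \<open>
  The finite type \<open>'y\<close> is the set of classes, and \<open>real ^ 'n\<close> is the input space.
\<close>

definition prob_simplex :: "(real ^ 'y) set" where
  "prob_simplex = {p. (\<forall>c. 0 \<le> p $ c) \<and> (\<Sum>c\<in>UNIV. p $ c) = 1}"

definition base_classifiers :: "(real ^ 'n \<Rightarrow> real ^ 'y) set" where
  "base_classifiers = {f \<in> borel_measurable borel. \<forall>x. f x \<in> prob_simplex}"

text \<open>
  Smoothing by a density \<open>\<mu>\<close>. The argument is \<open>x + z\<close>, not \<open>x - z\<close> as in the
  usual convolution.
\<close>

definition smooth ::
  "(real ^ 'n \<Rightarrow> real ^ 'y) \<Rightarrow> (real ^ 'n \<Rightarrow> real) \<Rightarrow> real ^ 'n \<Rightarrow> real ^ 'y"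
  (infixl "\<star>" 70) where
  "f \<star> \<mu> = (\<lambda>x. integral\<^sup>L lborel (\<lambda>z. \<mu> z *\<^sub>R f (x + z)))"

definition smoothed_classifiers ::
  "(real ^ 'n \<Rightarrow> real) \<Rightarrow> (real ^ 'n \<Rightarrow> real ^ 'y) set" where
  "smoothed_classifiers \<mu> = {f \<star> \<mu> | f. f \<in> base_classifiers}"

text \<open>The density of the normal distribution with mean 0 and covariance \<open>\<sigma>\<^sup>2 I\<close>.\<close>

definition gaussian_density :: "real \<Rightarrow> real ^ 'n \<Rightarrow> real" where
  "gaussian_density \<sigma> z =
     exp (- (norm z)\<^sup>2 / (2 * \<sigma>\<^sup>2)) / sqrt (2 * pi * \<sigma>\<^sup>2) ^ CARD('n)"

text \<open>
  \<open>LEAST\<close> on the reals denotes the minimum of the set of attainable values; it is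
  a meaningful number only where that minimum is attained.
\<close>

definition lower_prob ::
  "(real ^ 'n \<Rightarrow> real) \<Rightarrow> 'y::finite \<Rightarrow> real \<Rightarrow> real ^ 'n \<Rightarrow> real ^ 'n \<Rightarrow> real ^ 'n \<Rightarrow> real" where
  "lower_prob \<mu> c y0 y1 x z =
     (LEAST v. \<exists>h\<in>smoothed_classifiers \<mu>.
        h x $ c = y0 \<and> GDERIV (\<lambda>u. h u $ c) x :> y1 \<and> v = h z $ c)"

text \<open>The region consists of perturbations \<open>\<delta>\<close>, not of the perturbed points \<open>x + \<delta>\<close>.\<close>

definition safety_region ::
  "(real ^ 'n \<Rightarrow> real) \<Rightarrow> 'y::finite \<Rightarrow> real \<Rightarrow> real ^ 'n \<Rightarrow> real ^ 'n \<Rightarrow> (real ^ 'n) set" where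
  "safety_region \<mu> c y0 y1 x = {\<delta>. lower_prob \<mu> c y0 y1 x (x + \<delta>) > 1 / 2}"

end

theory Submission
  imports Defs "HOL-Probability.Probability"
begin

text \<open>
  For a displacement \<open>\<delta> \<noteq> 0\<close>, the generalized Neyman--Pearson lemma shows that the minimum defining
  \<open>lower_prob\<close> is attained by the indicator of a set
  \<open>C = {z. a + b \<bullet> z + l * exp (z \<bullet> \<delta> / \<sigma>\<^sup>2 - \<dots>) < 0}\<close> with \<open>l \<ge> 0\<close>. A supporting hyperplane of the set
  of moments provides the multipliers; since the zero set of the function is null, every minimizing
  sequence converges to the indicator, so no weak compactness is needed. The set \<open>C\<close> is convex, being
  a sublevel set of a convex function, so by the Prekopa--Leindler inequality its Gaussian smoothing
  is log-concave and has convex superlevel sets. The lower bound function lies below the smoothing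
  of \<open>C\<close> and touches it at \<open>\<delta>\<close>, so it is at \<open>\<delta>\<close> at least the minimum of its values at any two
  points whose segment contains \<open>\<delta>\<close>.
\<close>

section \<open>The Prekopa--Leindler inequality\<close>

text \<open>\<open>lower_prob\<close> is a \<open>LEAST\<close> over the reals, so bounding an
  infimum would not do: an attained minimum is needed at every point where the function is
  evaluated. The exponential in the description of \<open>C\<close> is the likelihood ratio of the
  Gaussian centred at \<delta> to the one centred at 0. The affine part comes from the constraints,
  because the gradient of a Gaussian smoothing is a first moment. No interior-point condition is
  imposed on the prescribed moments, so the multiplier \<open>l\<close> of the objective may vanish.
  Then \<open>C\<close> is a half-space, empty or everything, and the same argument applies since a
  nonzero affine function also has a null zero set. For \<delta> = 0 the multiplier function can
  vanish identically, which is why that displacement is treated apart.\<close>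

text \<open>
  With weight \<open>1/2\<close> the inequality can be stated with squares, which avoids real powers on
  \<open>ennreal\<close>. Closedness of the superlevel sets later makes up for the restriction to midpoints.
\<close>

lemma vimage_minus_translation:
  fixes A :: "'a::ab_group_add set"
  shows "(+) (- a) -` A = (+) a ` A"
proof
  show "(+) (- a) -` A \<subseteq> (+) a ` A"
  proof
    fix x assume "x \<in> (+) (- a) -` A"
    then show "x \<in> (+) a ` A" by (intro image_eqI[of _ _ "- a + x"]) auto
  qed
qed auto

lemma borel_translation:
  fixes A :: "'a::euclidean_space set"
  assumes [measurable]: "A \<in> sets borel"
  shows "(+) a ` A \<in> sets borel"
proof -
  have "(+) (- a) -` A \<inter> space borel \<in> sets borel"
    by (rule measurable_sets[OF _ assms]) measurable
  then show ?thesis by (simp add: vimage_minus_translation)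
qed

lemma emeasure_lborel_translation:
  fixes A :: "'a::euclidean_space set"
  assumes [measurable]: "A \<in> sets borel"
  shows "emeasure lborel ((+) a ` A) = emeasure lborel A"
proof -
  have "emeasure lborel A = emeasure (distr lborel borel ((+) (- a))) A"
    by (simp add: lborel_distr_plus)
  also have "\<dots> = emeasure lborel ((+) (- a) -` A)"
    by (subst emeasure_distr) auto
  finally show ?thesis by (simp add: vimage_minus_translation)
qed

lemma emeasure_lborel_midpoint_vimage:
  fixes H :: "real set"
  assumes [measurable]: "H \<in> sets borel"
  shows "emeasure lborel {s. s / 2 \<in> H} = 2 * emeasure lborel H"
proof -
  have "emeasure lborel {s. s / 2 \<in> H} = (\<integral>\<^sup>+s. indicator {s. s / 2 \<in> H} s \<partial>lborel)"
    by simp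
  also have "\<dots> = (\<integral>\<^sup>+s. indicator H (s / 2) \<partial>lborel)"
    by (intro nn_integral_cong) (auto split: split_indicator)
  also have "\<dots> = 2 * (\<integral>\<^sup>+s. indicator H ((0 + 2 * s) / 2) \<partial>lborel)"
    by (subst nn_integral_real_affine[where c = 2 and t = 0]) auto
  finally show ?thesis by simp
qed

text \<open>If \<open>A\<close> had a maximum a and \<open>B\<close> a minimum b, the translates b +
  A and a + B would meet only in a + b, so the sumset has at least the total length. Near-extremal
  points cost \<open>e / 2\<close> on each side. The sumset need not be Borel, so a Borel set
  \<open>H\<close> containing the midpoints stands in for it.\<close>

lemma brunn_minkowski_real_bounded:
  fixes A B H :: "real set"
  assumes [measurable]: "A \<in> sets borel" "B \<in> sets borel" "H \<in> sets borel"
    and ne: "A \<noteq> {}" "B \<noteq> {}" and bdd: "bounded A" "bounded B"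
    and mid: "\<And>a b. a \<in> A \<Longrightarrow> b \<in> B \<Longrightarrow> (a + b) / 2 \<in> H"
  shows "emeasure lborel A + emeasure lborel B \<le> 2 * emeasure lborel H"
proof (rule ennreal_le_epsilon)
  fix e :: real assume e: "0 < e"
  have bA: "bdd_above A" and bB: "bdd_below B"
    using bdd bounded_imp_bdd_above bounded_imp_bdd_below by auto
  obtain a where a: "a \<in> A" "Sup A - e / 2 < a"
    using less_cSup_iff[OF ne(1) bA, of "Sup A - e / 2"] e by auto
  obtain b where b: "b \<in> B" "b < Inf B + e / 2"
    using cInf_less_iff[OF ne(2) bB, of "Inf B + e / 2"] e by auto
  \<comment> \<open>The translates of \<open>K\<close> by \<open>b\<close> and of \<open>L\<close> by \<open>a\<close> are disjoint subsets of \<open>A + B\<close>.\<close>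
  define K where "K = A \<inter> {..a}"
  define L where "L = B \<inter> {b<..}"
  have [measurable]: "K \<in> sets borel" "L \<in> sets borel" by (auto simp: K_def L_def)
  have "emeasure lborel A \<le> emeasure lborel (K \<union> {a..a + e / 2})"
    using cSup_upper[OF _ bA] a by (intro emeasure_mono) (fastforce simp: K_def)+
  also have "\<dots> \<le> emeasure lborel K + emeasure lborel {a..a + e / 2}"
    by (rule emeasure_subadditive) auto
  finally have 1: "emeasure lborel A \<le> emeasure lborel K + ennreal (e / 2)" using e by simp
  have "emeasure lborel B \<le> emeasure lborel (L \<union> {b - e / 2..b})"
    using cInf_lower[OF _ bB] b by (intro emeasure_mono) (fastforce simp: L_def)+
  also have "\<dots> \<le> emeasure lborel L + emeasure lborel {b - e / 2..b}"
    by (rule emeasure_subadditive) auto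
  finally have 2: "emeasure lborel B \<le> emeasure lborel L + ennreal (e / 2)" using e by simp
  have meas: "(+) b ` K \<in> sets lborel" "(+) a ` L \<in> sets lborel"
    by (simp_all add: borel_translation)
  have disj: "(+) b ` K \<inter> (+) a ` L = {}" by (auto simp: K_def L_def)
  have "emeasure lborel K + emeasure lborel L = emeasure lborel ((+) b ` K) + emeasure lborel ((+) a ` L)"
    by (simp add: emeasure_lborel_translation)
  also have "\<dots> = emeasure lborel ((+) b ` K \<union> (+) a ` L)"
    by (rule plus_emeasure[OF meas disj])
  also have "\<dots> \<le> emeasure lborel {s. s / 2 \<in> H}"
    using mid[OF _ b(1)] mid[OF a(1)]
    by (intro emeasure_mono) (auto simp: K_def L_def add.commute[of b])
  finally have 3: "emeasure lborel K + emeasure lborel L \<le> 2 * emeasure lborel H"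
    by (simp add: emeasure_lborel_midpoint_vimage)
  have "emeasure lborel A + emeasure lborel B
      \<le> (emeasure lborel K + ennreal (e / 2)) + (emeasure lborel L + ennreal (e / 2))"
    by (rule add_mono[OF 1 2])
  also have "\<dots> = (emeasure lborel K + emeasure lborel L) + (ennreal (e / 2) + ennreal (e / 2))"
    by (simp add: ac_simps)
  also have "ennreal (e / 2) + ennreal (e / 2) = ennreal e"
    using e by (simp flip: ennreal_plus)
  also have "emeasure lborel K + emeasure lborel L + ennreal e \<le> 2 * emeasure lborel H + ennreal e"
    by (rule add_right_mono[OF 3])
  finally show "emeasure lborel A + emeasure lborel B \<le> 2 * emeasure lborel H + ennreal e" .
qed

lemma brunn_minkowski_real:
  fixes A B H :: "real set"
  assumes [measurable]: "A \<in> sets borel" "B \<in> sets borel" "H \<in> sets borel"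
    and ne: "A \<noteq> {}" "B \<noteq> {}"
    and mid: "\<And>a b. a \<in> A \<Longrightarrow> b \<in> B \<Longrightarrow> (a + b) / 2 \<in> H"
  shows "emeasure lborel A + emeasure lborel B \<le> 2 * emeasure lborel H"
proof -
  define T where "T n = {- real n..real n}" for n
  have lim: "(\<lambda>n. emeasure lborel (S \<inter> T n)) \<longlonglongrightarrow> emeasure lborel S"
    if [measurable]: "S \<in> sets borel" for S
  proof -
    have "(\<lambda>n. emeasure lborel (S \<inter> T n)) \<longlonglongrightarrow> emeasure lborel (\<Union>n. S \<inter> T n)"
      by (rule Lim_emeasure_incseq) (auto simp: T_def incseq_def)
    moreover have "(\<Union>n. S \<inter> T n) = S"
    proof -
      have "\<exists>n. x \<in> T n" for x
        using real_arch_simple[of "\<bar>x\<bar>"] by (auto simp: T_def abs_le_iff) (metis minus_le_iff)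
      then show ?thesis by blast
    qed
    ultimately show ?thesis by simp
  qed
  obtain a b where ab: "a \<in> A" "b \<in> B" using ne by blast
  \<comment> \<open>The bound can fail for an empty set, and truncations may be empty for small
    \<open>n\<close>; hence it is only claimed eventually.\<close>
  have "\<forall>\<^sub>F n in sequentially.
      emeasure lborel (A \<inter> T n) + emeasure lborel (B \<inter> T n) \<le> 2 * emeasure lborel H"
  proof -
    obtain N where N: "real N \<ge> max \<bar>a\<bar> \<bar>b\<bar>" using real_arch_simple by blast
    have "emeasure lborel (A \<inter> T n) + emeasure lborel (B \<inter> T n) \<le> 2 * emeasure lborel H" if "n \<ge> N" for n
    proof (rule brunn_minkowski_real_bounded)
      have "real n \<ge> max \<bar>a\<bar> \<bar>b\<bar>" using N that by linarith
      then show "A \<inter> T n \<noteq> {}" "B \<inter> T n \<noteq> {}" using ab by (auto simp: T_def abs_le_iff)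
      show "bounded (A \<inter> T n)" "bounded (B \<inter> T n)" by (auto simp: T_def intro: bounded_Int)
    qed (use mid in \<open>auto simp: T_def\<close>)
    then show ?thesis by (auto simp: eventually_sequentially)
  qed
  then show ?thesis
    by (intro tendsto_upperbound[OF tendsto_add[OF lim lim]]) auto
qed

section \<open>Prekopa-Leindler on the real line\<close>

text \<open>Levels are confined to the open unit interval because only there are the superlevel sets
  of both normalized functions known to be nonempty. The resulting cut-off at 1 is invisible for
  functions with supremum 1 and only helps for the function on the larger side.\<close>

lemma nn_integral_layer_cake_unit:
  fixes f :: "real \<Rightarrow> ennreal"
  assumes [measurable]: "f \<in> borel_measurable borel"
  shows "(\<integral>\<^sup>+s. emeasure lborel {x. f x > ennreal s} * indicator {0<..<1} s \<partial>lborel)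
    = (\<integral>\<^sup>+x. min (f x) 1 \<partial>lborel)"
proof -
  have "(\<integral>\<^sup>+s. emeasure lborel {x. f x > ennreal s} * indicator {0<..<1} s \<partial>lborel)
      = (\<integral>\<^sup>+s. (\<integral>\<^sup>+x. indicator {x. f x > ennreal s} x * indicator {0<..<1} s \<partial>lborel) \<partial>lborel)"
    by (intro nn_integral_cong) (simp add: nn_integral_multc)
  also have "\<dots> = (\<integral>\<^sup>+x. (\<integral>\<^sup>+s. indicator {x. f x > ennreal s} x * indicator {0<..<1} s \<partial>lborel) \<partial>lborel)"
    by (rule lborel_pair.Fubini') measurable
  also have "\<dots> = (\<integral>\<^sup>+x. min (f x) 1 \<partial>lborel)"
  proof (rule nn_integral_cong)
    fix x
    define r where "r = enn2real (min (f x) 1)"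
    have r: "min (f x) 1 = ennreal r" "0 \<le> r"
      by (auto simp: r_def ennreal_enn2real min.strict_coboundedI2)
    have "f x > ennreal s \<and> 0 < s \<and> s < 1 \<longleftrightarrow> 0 < s \<and> s < r" for s
    proof (cases "0 < s")
      case True
      have "s < r \<longleftrightarrow> ennreal s < min (f x) 1"
        using r True by (simp add: ennreal_less_iff)
      then show ?thesis using True by (auto simp: ennreal_less_one_iff)
    qed auto
    then have "indicator {x. f x > ennreal s} x * indicator {0<..<1} s = (indicator {0<..<r} s :: ennreal)" for s
      by (simp add: indicator_def of_bool_def) blast
    then show "(\<integral>\<^sup>+s. indicator {x. f x > ennreal s} x * indicator {0<..<1} s \<partial>lborel) = min (f x) 1"
      using r by simp
  qed
  finally show ?thesis .
qed

text \<open>At a common level s < 1, midpoints of the superlevel sets of \<open>f\<close> and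
  \<open>g\<close> lie in that of \<open>h\<close>, so Brunn-Minkowski applies level by level and
  integrates to an additive bound.\<close>

lemma prekopa_leindler_real_normalized:
  fixes f g h :: "real \<Rightarrow> ennreal"
  assumes [measurable]: "f \<in> borel_measurable borel" "g \<in> borel_measurable borel" "h \<in> borel_measurable borel"
    and sup: "(SUP x. f x) = 1" "(SUP x. g x) = 1"
    and mid: "\<And>x y. f x * g y \<le> (h ((x + y) / 2))\<^sup>2"
  shows "(\<integral>\<^sup>+x. f x \<partial>lborel) + (\<integral>\<^sup>+x. g x \<partial>lborel) \<le> 2 * (\<integral>\<^sup>+x. h x \<partial>lborel)"
proof -
  have "f x \<le> 1" "g x \<le> 1" for x using sup by (metis SUP_upper UNIV_I)+
  then have m: "min (f x) 1 = f x" "min (g x) 1 = g x" for x by (auto simp: min_absorb1)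
  let ?E = "\<lambda>u s. emeasure lborel {x::real. u x > ennreal s}"
  have "(\<integral>\<^sup>+x. f x \<partial>lborel) + (\<integral>\<^sup>+x. g x \<partial>lborel)
      = (\<integral>\<^sup>+s. ?E f s * indicator {0<..<1} s \<partial>lborel) + (\<integral>\<^sup>+s. ?E g s * indicator {0<..<1} s \<partial>lborel)"
    by (simp add: nn_integral_layer_cake_unit m)
  also have "\<dots> = (\<integral>\<^sup>+s. ?E f s * indicator {0<..<1} s + ?E g s * indicator {0<..<1} s \<partial>lborel)"
    by (rule nn_integral_add[symmetric]) measurable
  also have "\<dots> \<le> (\<integral>\<^sup>+s. 2 * (?E h s * indicator {0<..<1} s) \<partial>lborel)"
  proof (rule nn_integral_mono)
    fix s :: real
    show "?E f s * indicator {0<..<1} s + ?E g s * indicator {0<..<1} s \<le> 2 * (?E h s * indicator {0<..<1} s)"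
    proof (cases "s \<in> {0<..<1}")
      case True
      then have s: "ennreal s < 1" "0 < s" by (auto simp: ennreal_less_one_iff)
      have "?E f s + ?E g s \<le> 2 * ?E h s"
      proof (rule brunn_minkowski_real)
        show "{x. ennreal s < f x} \<noteq> {}" "{x. ennreal s < g x} \<noteq> {}"
          using s(1) less_SUP_iff[of "ennreal s" f UNIV] less_SUP_iff[of "ennreal s" g UNIV] sup
          by auto
        fix a b assume "a \<in> {x. ennreal s < f x}" "b \<in> {x. ennreal s < g x}"
        then have "ennreal s * ennreal s < ennreal s * g b" "ennreal s * g b \<le> f a * g b"
          using s by (auto intro!: ennreal_mult_strict_left_mono mult_right_mono)
        then have "ennreal s * ennreal s < f a * g b" by (rule less_le_trans)
        also note mid[of a b]
        finally have "(ennreal s)\<^sup>2 < (h ((a + b) / 2))\<^sup>2" by (simp add: power2_eq_square)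
        then show "(a + b) / 2 \<in> {x. ennreal s < h x}"
          using power_mono[of "h ((a + b) / 2)" "ennreal s" 2] by (auto simp: not_le[symmetric])
      qed measurable
      then show ?thesis using True by simp
    qed simp
  qed
  also have "\<dots> = 2 * (\<integral>\<^sup>+x. min (h x) 1 \<partial>lborel)"
    by (subst nn_integral_cmult) (auto simp: nn_integral_layer_cake_unit)
  also have "\<dots> \<le> 2 * (\<integral>\<^sup>+x. h x \<partial>lborel)"
    by (intro mult_left_mono nn_integral_mono) auto
  finally show ?thesis .
qed

lemma four_mult_le_square_ennreal:
  fixes a b :: ennreal
  shows "4 * (a * b) \<le> (a + b)\<^sup>2"
proof (cases "a = top \<or> b = top")
  case True
  then show ?thesis by (auto simp: power2_eq_square)
next
  case False
  then obtain r s where rs: "a = ennreal r" "b = ennreal s" "0 \<le> r" "0 \<le> s"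
    by (metis ennreal_cases)
  have "4 * (r * s) \<le> (r + s)\<^sup>2"
    using zero_le_power2[of "r - s"] by (simp add: power2_eq_square algebra_simps)
  then have "ennreal (4 * (r * s)) \<le> ennreal ((r + s)\<^sup>2)" by (rule ennreal_leI)
  then show ?thesis using rs by (simp add: ennreal_mult ennreal_power[symmetric])
qed

text \<open>Dividing \<open>f\<close> and \<open>g\<close> by their suprema and \<open>h\<close> by
  the geometric mean of these preserves the midpoint hypothesis. The inequality of arithmetic and
  geometric means then turns the additive bound into a product bound, in which the scaling factors
  cancel.\<close>

lemma prekopa_leindler_real_bounded:
  fixes f g h :: "real \<Rightarrow> ennreal"
  assumes [measurable]: "f \<in> borel_measurable borel" "g \<in> borel_measurable borel" "h \<in> borel_measurable borel"
    and sup: "(SUP x. f x) = ennreal F" "(SUP x. g x) = ennreal G" and pos: "0 < F" "0 < G"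
    and mid: "\<And>x y. f x * g y \<le> (h ((x + y) / 2))\<^sup>2"
  shows "(\<integral>\<^sup>+x. f x \<partial>lborel) * (\<integral>\<^sup>+x. g x \<partial>lborel) \<le> (\<integral>\<^sup>+x. h x \<partial>lborel)\<^sup>2"
proof -
  define c where "c = sqrt (F * G)"
  have c: "0 < c" "c\<^sup>2 = F * G" using pos by (auto simp: c_def)
  let ?i = "\<lambda>r. ennreal (1 / r)"
  have i: "?i r * ennreal r = 1" if "0 < r" for r using that by (simp flip: ennreal_mult)
  have ic: "?i c * ?i c = ?i F * ?i G" using c pos
    by (simp add: power2_eq_square flip: ennreal_mult)
  let ?I = "\<lambda>u. \<integral>\<^sup>+x. u x \<partial>lborel"
  have "(\<integral>\<^sup>+x. ?i F * f x \<partial>lborel) + (\<integral>\<^sup>+x. ?i G * g x \<partial>lborel) \<le> 2 * (\<integral>\<^sup>+x. ?i c * h x \<partial>lborel)"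
  proof (rule prekopa_leindler_real_normalized)
    show "(SUP x. ?i F * f x) = 1" "(SUP x. ?i G * g x) = 1"
      using sup i pos by (simp_all flip: SUP_mult_left_ennreal)
    fix x y
    have "?i F * f x * (?i G * g y) = (?i c * ?i c) * (f x * g y)" by (simp add: ic ac_simps)
    also have "\<dots> \<le> (?i c * ?i c) * (h ((x + y) / 2))\<^sup>2" by (intro mult_left_mono mid) auto
    finally show "?i F * f x * (?i G * g y) \<le> (?i c * h ((x + y) / 2))\<^sup>2"
      by (simp add: power2_eq_square ac_simps)
  qed measurable
  then have le: "?i F * ?I f + ?i G * ?I g \<le> 2 * (?i c * ?I h)"
    by (simp add: nn_integral_cmult)
  have "4 * ((?i F * ?I f) * (?i G * ?I g)) \<le> (?i F * ?I f + ?i G * ?I g)\<^sup>2"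
    by (rule four_mult_le_square_ennreal)
  also have "\<dots> \<le> (2 * (?i c * ?I h))\<^sup>2" using le by (rule power_mono) simp
  also have "\<dots> = 4 * ((?i c * ?i c) * (?I h)\<^sup>2)" by (simp add: power2_eq_square ac_simps)
  finally have "(?i F * ?I f) * (?i G * ?I g) \<le> (?i F * ?i G) * (?I h)\<^sup>2"
    by (simp add: ic ennreal_mult_le_mult_iff)
  then have "(ennreal F * ennreal G) * ((?i F * ?I f) * (?i G * ?I g))
     \<le> (ennreal F * ennreal G) * ((?i F * ?i G) * (?I h)\<^sup>2)"
    by (rule mult_left_mono) simp
  moreover have "(ennreal F * ennreal G) * ((?i F * X) * (?i G * Y)) = (?i F * ennreal F) * (?i G * ennreal G) * (X * Y)"
    "(ennreal F * ennreal G) * ((?i F * ?i G) * X) = (?i F * ennreal F) * (?i G * ennreal G) * X" for X Y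
    by (simp_all add: ac_simps)
  ultimately show ?thesis using i pos by simp
qed

lemma nn_integral_SUP_min_of_nat:
  fixes f :: "'a \<Rightarrow> ennreal"
  assumes [measurable]: "f \<in> borel_measurable M"
  shows "(\<integral>\<^sup>+x. f x \<partial>M) = (SUP k. \<integral>\<^sup>+x. min (f x) (of_nat k) \<partial>M)"
proof -
  have "f x = (SUP k. min (f x) (of_nat k))" for x
    by (simp add: inf_min[symmetric] inf_SUP[symmetric] ennreal_SUP_of_nat_eq_top)
  then have "(\<integral>\<^sup>+x. f x \<partial>M) = (\<integral>\<^sup>+x. (SUP k. min (f x) (of_nat k)) \<partial>M)"
    by simp
  also have "\<dots> = (SUP k. \<integral>\<^sup>+x. min (f x) (of_nat k) \<partial>M)"
    by (rule nn_integral_monotone_convergence_SUP)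
       (auto simp: incseq_def le_fun_def intro: min.coboundedI2)
  finally show ?thesis .
qed

text \<open>Truncating \<open>f\<close> and \<open>g\<close> gives the finite suprema that
  normalization needs, and it only shrinks the left side of the hypothesis, so \<open>h\<close> can
  stay as it is.\<close>

lemma prekopa_leindler_real:
  fixes f g h :: "real \<Rightarrow> ennreal"
  assumes [measurable]: "f \<in> borel_measurable borel" "g \<in> borel_measurable borel" "h \<in> borel_measurable borel"
    and mid: "\<And>x y. f x * g y \<le> (h ((x + y) / 2))\<^sup>2"
  shows "(\<integral>\<^sup>+x. f x \<partial>lborel) * (\<integral>\<^sup>+x. g x \<partial>lborel) \<le> (\<integral>\<^sup>+x. h x \<partial>lborel)\<^sup>2"
proof -
  have "(\<integral>\<^sup>+x. min (f x) (of_nat k) \<partial>lborel) * (\<integral>\<^sup>+x. min (g x) (of_nat l) \<partial>lborel) \<le> (\<integral>\<^sup>+x. h x \<partial>lborel)\<^sup>2"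
    (is "?f * ?g \<le> _") for k l
  proof -
    define F where "F = (SUP x. min (f x) (of_nat k))"
    define G where "G = (SUP x. min (g x) (of_nat l))"
    have "F \<le> of_nat k" "G \<le> of_nat l" by (auto simp: F_def G_def intro: SUP_least)
    then have fin: "F < top" "G < top" by (auto simp: le_less_trans[OF _ of_nat_less_top])
    show ?thesis
    proof (cases "F = 0 \<or> G = 0")
      case True
      have "min (f x) (of_nat k) \<le> F" "min (g x) (of_nat l) \<le> G" for x
        by (auto simp: F_def G_def intro: SUP_upper)
      with True have "(\<forall>x. min (f x) (of_nat k) = 0) \<or> (\<forall>x. min (g x) (of_nat l) = 0)"
        by (metis le_zero_eq)
      then have "?f = 0 \<or> ?g = 0" by auto
      then show ?thesis by auto
    next
      case False
      with fin obtain r s where "F = ennreal r" "0 < r" "G = ennreal s" "0 < s"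
        by (metis ennreal_cases ennreal_eq_0_iff less_irrefl not_le_imp_less)
      then show ?thesis
      proof (intro prekopa_leindler_real_bounded[where F = r and G = s])
        fix x y
        show "min (f x) (of_nat k) * min (g y) (of_nat l) \<le> (h ((x + y) / 2))\<^sup>2"
          by (rule order_trans[OF mult_mono mid]) auto
      qed (auto simp: F_def G_def)
    qed
  qed
  then show ?thesis
    by (subst nn_integral_SUP_min_of_nat, simp, subst (2) nn_integral_SUP_min_of_nat, simp)
       (auto simp: SUP_mult_left_ennreal SUP_mult_right_ennreal intro!: SUP_least)
qed

section \<open>Passage to several dimensions, and convexity from midpoints\<close>

text \<open>Integrating out one coordinate produces functions that satisfy the same hypothesis, by
  the one-dimensional inequality. This works because the hypothesis and the conclusion have the same
  shape. Points of the product space are extensional, so the hypothesis is asked only for these and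
  midpoints are restricted to \<open>I\<close>.\<close>

lemma prekopa_leindler_PiM:
  fixes f g h :: "('i \<Rightarrow> real) \<Rightarrow> ennreal"
  assumes "finite I"
    and "f \<in> borel_measurable (PiM I (\<lambda>_. lborel))" "g \<in> borel_measurable (PiM I (\<lambda>_. lborel))"
      "h \<in> borel_measurable (PiM I (\<lambda>_. lborel))"
    and "\<And>x y. x \<in> extensional I \<Longrightarrow> y \<in> extensional I \<Longrightarrow> f x * g y \<le> (h (\<lambda>i\<in>I. (x i + y i) / 2))\<^sup>2"
  shows "(\<integral>\<^sup>+x. f x \<partial>PiM I (\<lambda>_. lborel)) * (\<integral>\<^sup>+x. g x \<partial>PiM I (\<lambda>_. lborel))
    \<le> (\<integral>\<^sup>+x. h x \<partial>PiM I (\<lambda>_. lborel))\<^sup>2"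
  using assms
proof (induction I arbitrary: f g h rule: finite_induct)
  case empty
  interpret product_sigma_finite "\<lambda>_::'i. lborel :: real measure"
    by standard
  \<comment> \<open>The empty product is a point mass at \<open>\<lambda>_. undefined\<close>, so
    the claim is the hypothesis at that point.\<close>
  show ?case using empty.prems(4)[of "\<lambda>_. undefined" "\<lambda>_. undefined"]
    by (simp add: PiM_empty nn_integral_count_space_finite restrict_def)
next
  case (insert j I)
  interpret product_sigma_finite "\<lambda>_::'i. lborel :: real measure"
    by standard
  have eq: "(\<integral>\<^sup>+x. u x \<partial>PiM (insert j I) (\<lambda>_. lborel)) = (\<integral>\<^sup>+x. (\<integral>\<^sup>+t. u (x(j := t)) \<partial>lborel) \<partial>PiM I (\<lambda>_. lborel))"
    if "u \<in> borel_measurable (PiM (insert j I) (\<lambda>_. lborel))" for u :: "('i \<Rightarrow> real) \<Rightarrow> ennreal"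
    using product_nn_integral_insert[OF insert.hyps that] .
  note [measurable] = insert.prems(1-3)
  show ?case
    unfolding eq[OF insert.prems(1)] eq[OF insert.prems(2)] eq[OF insert.prems(3)]
  proof (rule insert.IH)
    fix x y :: "'i \<Rightarrow> real" assume xy: "x \<in> extensional I" "y \<in> extensional I"
    let ?m = "\<lambda>i\<in>I. (x i + y i) / 2"
    have *: "x \<in> space (PiM I (\<lambda>_. lborel))" if "x \<in> extensional I" for x :: "'i \<Rightarrow> real"
      using that by (simp add: space_PiM PiE_UNIV_domain PiE_def)
    have [measurable]: "(\<lambda>t. x(j := t)) \<in> measurable borel (PiM (insert j I) (\<lambda>_. lborel))"
      if "x \<in> extensional I" for x :: "'i \<Rightarrow> real"
      using measurable_fun_upd[where J = I and f = "\<lambda>_. x" and h = "\<lambda>t. t" and I = "insert j I" and N = borel and i = j and M = "\<lambda>_. lborel"] *[OF that]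
      by simp
    have m: "?m \<in> extensional I" by simp
    have *: "f (x(j := s)) * g (y(j := t)) \<le> (h (?m(j := (s + t) / 2)))\<^sup>2" for s t
    proof -
      have "(\<lambda>i\<in>insert j I. ((x(j := s)) i + (y(j := t)) i) / 2) = ?m(j := (s + t) / 2)"
        using insert.hyps by (auto simp: fun_eq_iff)
      moreover have "x(j := s) \<in> extensional (insert j I)" "y(j := t) \<in> extensional (insert j I)"
        using xy by (auto simp: extensional_def)
      ultimately show ?thesis using insert.prems(4)[of "x(j := s)" "y(j := t)"] by (simp del: fun_upd_apply)
    qed
    show "(\<integral>\<^sup>+t. f (x(j := t)) \<partial>lborel) * (\<integral>\<^sup>+t. g (y(j := t)) \<partial>lborel) \<le> (\<integral>\<^sup>+t. h (?m(j := t)) \<partial>lborel)\<^sup>2"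
      using xy m by (intro prekopa_leindler_real *) (auto intro!: measurable_compose[OF _ insert.prems(1)] measurable_compose[OF _ insert.prems(2)] measurable_compose[OF _ insert.prems(3)])
  qed measurable
qed

theorem prekopa_leindler_midpoint:
  fixes f g h :: "'a::euclidean_space \<Rightarrow> ennreal"
  assumes [measurable]: "f \<in> borel_measurable borel" "g \<in> borel_measurable borel" "h \<in> borel_measurable borel"
    and mid: "\<And>x y. f x * g y \<le> (h ((x + y) /\<^sub>R 2))\<^sup>2"
  shows "(\<integral>\<^sup>+x. f x \<partial>lborel) * (\<integral>\<^sup>+x. g x \<partial>lborel) \<le> (\<integral>\<^sup>+x. h x \<partial>lborel)\<^sup>2"
proof -
  define T where "T x = (\<Sum>b\<in>Basis. x b *\<^sub>R b)" for x :: "'a \<Rightarrow> real"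
  have [measurable]: "T \<in> measurable (\<Pi>\<^sub>M b\<in>Basis. lborel) borel"
    unfolding T_def[abs_def] by measurable
  have eq: "(\<integral>\<^sup>+x. u x \<partial>lborel) = (\<integral>\<^sup>+x. u (T x) \<partial>(\<Pi>\<^sub>M b\<in>Basis. lborel))"
    if [measurable]: "u \<in> borel_measurable borel" for u :: "'a \<Rightarrow> ennreal"
    by (subst lborel_eq) (simp add: nn_integral_distr T_def[abs_def, symmetric])
  have T: "T (\<lambda>i\<in>Basis. (x i + y i) / 2) = (T x + T y) /\<^sub>R 2" for x y
    by (simp add: T_def add_divide_distrib scaleR_add_left sum.distrib scaleR_add_right scaleR_sum_right)
  show ?thesis
    unfolding eq[OF assms(1)] eq[OF assms(2)] eq[OF assms(3)]
    by (rule prekopa_leindler_PiM) (use mid in \<open>auto simp: T\<close>)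
qed

text \<open>On the segment, take the last parameter \<open>a\<close> up to \<open>t\<close> and the
  first parameter \<open>b\<close> from \<open>t\<close> on whose points lie in \<open>S\<close>.
  The midpoint of the two also belongs to \<open>S\<close>, which contradicts extremality unless
  both equal \<open>t\<close>.\<close>

lemma closed_midpoint_imp_convex:
  fixes S :: "'a::real_normed_vector set"
  assumes cl: "closed S" and mid: "\<And>x y. x \<in> S \<Longrightarrow> y \<in> S \<Longrightarrow> (x + y) /\<^sub>R 2 \<in> S"
  shows "convex S"
  unfolding convex_alt
proof (intro ballI allI impI)
  fix x y and t :: real assume xy: "x \<in> S" "y \<in> S" and t: "0 \<le> t \<and> t \<le> 1"
  define P where "P s = (1 - s) *\<^sub>R x + s *\<^sub>R y" for s
  have P: "P ((a + b) / 2) = (P a + P b) /\<^sub>R 2" for a b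
    unfolding P_def by (simp add: algebra_simps add_divide_distrib flip: scaleR_add_left)
  have "isCont P s" for s unfolding P_def by (intro continuous_intros)
  then have clP: "closed (P -` S)" by (rule continuous_closed_vimage[OF cl])
  define L where "L = P -` S \<inter> {0..t}"
  define R where "R = P -` S \<inter> {t..1}"
  have "compact L" "compact R" using clP by (auto simp: L_def R_def intro: closed_Int_compact)
  moreover have "0 \<in> L" "1 \<in> R" using xy t by (auto simp: L_def R_def P_def)
  ultimately obtain a b where a: "a \<in> L" "\<And>s. s \<in> L \<Longrightarrow> s \<le> a" and b: "b \<in> R" "\<And>s. s \<in> R \<Longrightarrow> b \<le> s"
    by (metis compact_attains_sup compact_attains_inf empty_iff)
  define m where "m = (a + b) / 2"
  have "P m \<in> S" using a(1) b(1) mid by (simp add: m_def P L_def R_def)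
  moreover have "a \<le> m" "m \<le> b" "0 \<le> a" "b \<le> 1" "a \<le> t" "t \<le> b"
    using a(1) b(1) by (auto simp: m_def L_def R_def)
  ultimately have "m \<in> L \<or> m \<in> R" by (auto simp: L_def R_def)
  then have "m \<le> a \<or> b \<le> m" using a(2) b(2) by auto
  then have "a = t" using \<open>a \<le> t\<close> \<open>t \<le> b\<close> by (auto simp: m_def)
  then show "(1 - t) *\<^sub>R x + t *\<^sub>R y \<in> S" using a(1) by (simp add: L_def P_def)
qed

section \<open>A generalized Neyman--Pearson lemma\<close>

text \<open>Randomized tests in the sense of Neyman and Pearson. Unlike indicators they form a
  convex set, as the separation argument requires.\<close>

definition tests :: "'a measure \<Rightarrow> ('a \<Rightarrow> real) set" where
  "tests M = {u \<in> borel_measurable M. \<forall>x. 0 \<le> u x \<and> u x \<le> 1}"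

lemma tests_measurable: "u \<in> tests M \<Longrightarrow> u \<in> borel_measurable M"
  by (simp add: tests_def)

lemma tests_bounds: "u \<in> tests M \<Longrightarrow> 0 \<le> u x" "u \<in> tests M \<Longrightarrow> u x \<le> 1"
  by (simp_all add: tests_def)

lemma indicator_in_tests: "C \<in> sets M \<Longrightarrow> indicator C \<in> tests M"
  by (auto simp: tests_def indicator_def)

lemma tests_convex_combination:
  assumes "u \<in> tests M" "v \<in> tests M" "0 \<le> s" "0 \<le> t" "s + t = 1"
  shows "(\<lambda>x. s * u x + t * v x) \<in> tests M"
proof -
  have "s * u x + t * v x \<le> s * 1 + t * 1" for x
    using assms by (intro add_mono mult_left_mono) (auto simp: tests_def)
  then show ?thesis using assms by (auto simp: tests_def)
qed

lemma integrable_tests_scaleR: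
  fixes m :: "'a \<Rightarrow> 'b::{banach, second_countable_topology}"
  assumes "u \<in> tests M" "integrable M m"
  shows "integrable M (\<lambda>x. u x *\<^sub>R m x)"
proof (rule Bochner_Integration.integrable_bound[OF assms(2)])
  show "(\<lambda>x. u x *\<^sub>R m x) \<in> borel_measurable M"
    using assms by (auto simp: tests_def)
  show "AE x in M. norm (u x *\<^sub>R m x) \<le> norm (m x)"
    using assms by (auto simp: tests_def intro!: mult_left_le_one_le)
qed

text \<open>The vector \<open>m\<close> carries the constraints and \<open>r\<close> the objective.
  Separation may yield \<open>l = 0\<close>, so \<open>nondeg\<close> covers that case as well; the
  indicator is then almost everywhere the only test with the prescribed moments.\<close>

theorem neyman_pearson_minimizer:
  fixes m :: "'a \<Rightarrow> 'b::euclidean_space" and r :: "'a \<Rightarrow> real"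
  assumes m: "integrable M m" and r: "integrable M r" and u0: "u0 \<in> tests M"
    and nondeg: "\<And>a l. 0 \<le> l \<Longrightarrow> (a, l) \<noteq> 0 \<Longrightarrow> AE x in M. a \<bullet> m x + l * r x \<noteq> 0"
  obtains a l where "0 \<le> l"
    "(\<integral>x. indicator {x \<in> space M. a \<bullet> m x + l * r x < 0} x *\<^sub>R m x \<partial>M) = (\<integral>x. u0 x *\<^sub>R m x \<partial>M)"
    "\<And>u. u \<in> tests M \<Longrightarrow> (\<integral>x. u x *\<^sub>R m x \<partial>M) = (\<integral>x. u0 x *\<^sub>R m x \<partial>M) \<Longrightarrow>
      (\<integral>x. indicator {x \<in> space M. a \<bullet> m x + l * r x < 0} x * r x \<partial>M) \<le> (\<integral>x. u x * r x \<partial>M)"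
proof -
  have [measurable]: "m \<in> borel_measurable M" "r \<in> borel_measurable M" using m r by auto
  define E where "E u = (\<integral>x. u x *\<^sub>R m x \<partial>M)" for u
  define R where "R u = (\<integral>x. u x * r x \<partial>M)" for u
  have iE: "integrable M (\<lambda>x. u x *\<^sub>R m x)" if "u \<in> tests M" for u
    using integrable_tests_scaleR[OF that m] .
  have iR: "integrable M (\<lambda>x. u x * r x)" if "u \<in> tests M" for u
    using integrable_tests_scaleR[OF that r] by simp
  define V where "V = R ` {u \<in> tests M. E u = E u0}"
  define v where "v = Inf V"
  have V: "V \<noteq> {}" using u0 by (auto simp: V_def)
  have "- (\<integral>x. \<bar>r x\<bar> \<partial>M) \<le> R u" if "u \<in> tests M" for u
  proof -
    have "(\<integral>x. - \<bar>r x\<bar> \<partial>M) \<le> R u"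
      unfolding R_def
    proof (rule integral_mono)
      fix x
      have "\<bar>u x * r x\<bar> \<le> 1 * \<bar>r x\<bar>"
        unfolding abs_mult using that by (intro mult_right_mono) (auto simp: tests_def)
      then show "- \<bar>r x\<bar> \<le> u x * r x" by linarith
    qed (use r iR[OF that] in auto)
    then show ?thesis by simp
  qed
  then have bdd: "bdd_below V" by (auto simp: V_def bdd_below_def)
  have "\<exists>u. u \<in> tests M \<and> E u = E u0 \<and> R u < v + inverse (real (Suc n))" for n
    using cInf_less_iff[OF V bdd, of "v + inverse (real (Suc n))"] by (auto simp: v_def V_def)
  then obtain u where u: "\<And>n. u n \<in> tests M" "\<And>n. E (u n) = E u0"
    "\<And>n. R (u n) < v + inverse (real (Suc n))" by metis
  \<comment> \<open>The ray of values strictly below the infimum over the prescribed moment; no test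
    reaches it, by the choice of \<open>v\<close>.\<close>
  define S where "S = {E u0} \<times> {..<v}"
  define T where "T = (\<lambda>u. (E u, R u)) ` tests M"
  have "convex T"
  proof (rule convexI)
    fix p q s t assume pq: "p \<in> T" "q \<in> T" and st: "0 \<le> s" "0 \<le> t" "s + t = (1::real)"
    then obtain u w where uw: "u \<in> tests M" "w \<in> tests M" "p = (E u, R u)" "q = (E w, R w)"
      by (auto simp: T_def)
    let ?z = "\<lambda>x. s * u x + t * w x"
    have "E ?z = (\<integral>x. s *\<^sub>R (u x *\<^sub>R m x) + t *\<^sub>R (w x *\<^sub>R m x) \<partial>M)"
      unfolding E_def by (simp add: scaleR_add_left)
    also have "\<dots> = s *\<^sub>R E u + t *\<^sub>R E w"
      unfolding E_def using iE[OF uw(1)] iE[OF uw(2)]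
      by (simp add: Bochner_Integration.integral_add del: scaleR_scaleR)
    finally have "E ?z = s *\<^sub>R E u + t *\<^sub>R E w" .
    moreover have "R ?z = (\<integral>x. s * (u x * r x) + t * (w x * r x) \<partial>M)"
      unfolding R_def by (simp add: algebra_simps)
    then have "R ?z = s * R u + t * R w"
      unfolding R_def using iR[OF uw(1)] iR[OF uw(2)] by simp
    ultimately show "s *\<^sub>R p + t *\<^sub>R q \<in> T"
      unfolding T_def using tests_convex_combination[OF uw(1,2) st]
      by (intro image_eqI[where x = ?z]) (simp_all add: uw)
  qed
  moreover have "convex S" unfolding S_def by (intro convex_Times) auto
  moreover have "S \<inter> T = {}"
    using cInf_lower[OF _ bdd] by (force simp: S_def T_def V_def v_def)
  moreover have "S \<noteq> {}" "T \<noteq> {}" using u0 by (auto simp: S_def T_def)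
  ultimately obtain p b where p: "p \<noteq> 0" "\<forall>x\<in>S. p \<bullet> x \<le> b" "\<forall>x\<in>T. b \<le> p \<bullet> x"
    using separating_hyperplane_sets[of S T] by metis
  obtain a l where al: "p = (a, l)" by (cases p)
  have pS: "a \<bullet> E u0 + l * s \<le> b" if "s < v" for s
    using p(2) that by (auto simp: S_def al inner_Pair)
  have pT: "b \<le> a \<bullet> E w + l * R w" if "w \<in> tests M" for w
    using p(3) that by (auto simp: T_def al inner_Pair)
  \<comment> \<open>The ray \<open>S\<close> is unbounded below, so a negative \<open>l\<close>
    would make the linear functional unbounded above on it. The witness \<open>s\<close> is chosen
    low enough to exceed \<open>b\<close> by at least \<open>- l\<close>.\<close>
  have l: "0 \<le> l"
  proof (rule ccontr)
    assume "\<not> 0 \<le> l"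
    then have neg: "l < 0" by simp
    define s where "s = min (v - 1) ((b - a \<bullet> E u0) / l - 1)"
    have "l * ((b - a \<bullet> E u0) / l - 1) \<le> l * s"
      using neg by (intro mult_left_mono_neg) (auto simp: s_def)
    moreover have "l * ((b - a \<bullet> E u0) / l - 1) = b - a \<bullet> E u0 - l"
      using neg by (simp add: field_simps)
    moreover have "s < v" by (simp add: s_def)
    ultimately show False using pS[of s] neg by linarith
  qed
  \<comment> \<open>The end point \<open>v\<close> is not on the ray and is approached from below.
    The denominator \<open>l + 1\<close> keeps the step meaningful when
    \<open>l = 0\<close>.\<close>
  have pv: "a \<bullet> E u0 + l * v \<le> b"
  proof (rule field_le_epsilon)
    fix e :: real assume e: "0 < e"
    have "l * (e / (l + 1)) \<le> e" using e l by (simp add: field_simps)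
    moreover have "a \<bullet> E u0 + l * (v - e / (l + 1)) \<le> b" using e l by (intro pS) auto
    ultimately show "a \<bullet> E u0 + l * v \<le> b + e" by (simp add: algebra_simps)
  qed
  define D where "D x = a \<bullet> m x + l * r x" for x
  have [measurable]: "D \<in> borel_measurable M" unfolding D_def[abs_def] by measurable
  have iD: "integrable M (\<lambda>x. w x * D x)" and lin: "(\<integral>x. w x * D x \<partial>M) = a \<bullet> E w + l * R w"
    if "w \<in> tests M" for w
  proof -
    have eq: "w x * D x = a \<bullet> (w x *\<^sub>R m x) + l * (w x * r x)" for x
      by (simp add: D_def algebra_simps)
    show "integrable M (\<lambda>x. w x * D x)" "(\<integral>x. w x * D x \<partial>M) = a \<bullet> E w + l * R w"
      unfolding eq E_def R_def using iE[OF that] iR[OF that] by (simp_all del: inner_scaleR_right)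
  qed
  define C where "C = {x \<in> space M. D x < 0}"
  define k where "k = (indicator C :: 'a \<Rightarrow> real)"
  have k: "k \<in> tests M" unfolding k_def C_def by (rule indicator_in_tests) measurable
  \<comment> \<open>\<open>k\<close> minimizes \<open>\<integral>u D\<close> over all tests pointwise, so the excess of \<open>u n\<close> is an \<open>L\<^sup>1\<close> distance weighted by \<open>\<bar>D\<bar>\<close>.\<close>
  have L1: "(\<lambda>n. \<integral>x. norm ((u n x - k x) * D x) \<partial>M) \<longlonglongrightarrow> 0"
  proof (rule tendsto_sandwich[OF _ _ tendsto_const])
    have "(\<lambda>n. l * inverse (real (Suc n))) \<longlonglongrightarrow> l * 0"
      by (intro tendsto_mult tendsto_const LIMSEQ_inverse_real_of_nat)
    then show "(\<lambda>n. l * inverse (real (Suc n))) \<longlonglongrightarrow> 0" by simp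
    have "(\<integral>x. norm ((u n x - k x) * D x) \<partial>M) \<le> l * inverse (real (Suc n))" for n
    proof -
      have "(\<integral>x. norm ((u n x - k x) * D x) \<partial>M) = (\<integral>x. u n x * D x - k x * D x \<partial>M)"
      proof (rule Bochner_Integration.integral_cong[OF refl])
        fix x assume "x \<in> space M"
        then have "0 \<le> (u n x - k x) * D x"
          using tests_bounds[OF u(1)[of n], of x]
          by (auto simp: k_def C_def indicator_def mult_nonpos_nonpos)
        then show "norm ((u n x - k x) * D x) = u n x * D x - k x * D x"
          by (simp add: algebra_simps)
      qed
      also have "\<dots> = (a \<bullet> E u0 + l * R (u n)) - (a \<bullet> E k + l * R k)"
        using iD u(1) k by (simp add: lin u(2))
      also have "\<dots> \<le> (a \<bullet> E u0 + l * R (u n)) - (a \<bullet> E u0 + l * v)"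
        using pT[OF k] pv by linarith
      also have "\<dots> = l * (R (u n) - v)" by (simp add: algebra_simps)
      also have "\<dots> \<le> l * inverse (real (Suc n))"
        using u(3)[of n] l by (intro mult_left_mono) auto
      finally show ?thesis .
    qed
    then show "\<forall>\<^sub>F n in sequentially. (\<integral>x. norm ((u n x - k x) * D x) \<partial>M) \<le> l * inverse (real (Suc n))"
      by simp
  qed auto
  have "integrable M (\<lambda>x. (u n x - k x) * D x)" for n
    using iD[OF u(1)] iD[OF k] by (simp add: left_diff_distrib)
  \<comment> \<open>Almost everywhere convergence is available only along a subsequence. That
    suffices, since the moments are constant along it and the values of \<open>R\<close> are still
    squeezed down to \<open>v\<close>.\<close>
  from tendsto_L1_AE_subseq[OF this L1] obtain \<rho> where \<rho>: "strict_mono \<rho>"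
    "AE x in M. (\<lambda>n. (u (\<rho> n) x - k x) * D x) \<longlonglongrightarrow> 0"
    by auto
  have "AE x in M. D x \<noteq> 0"
    unfolding D_def using p(1) l by (intro nondeg) (auto simp: al)
  with \<rho>(2) have conv: "AE x in M. (\<lambda>n. u (\<rho> n) x) \<longlonglongrightarrow> k x"
  proof eventually_elim
    case (elim x)
    from tendsto_divide[OF elim(1) tendsto_const[of "D x"]] elim(2)
    have "(\<lambda>n. u (\<rho> n) x - k x) \<longlonglongrightarrow> 0" by simp
    then show ?case by (simp add: LIM_zero_iff)
  qed
  note [measurable] = tests_measurable[OF u(1)] tests_measurable[OF k]
  have "(\<lambda>n. E (u (\<rho> n))) \<longlonglongrightarrow> E k"
    unfolding E_def
  proof (rule integral_dominated_convergence)
    show "AE x in M. (\<lambda>n. u (\<rho> n) x *\<^sub>R m x) \<longlonglongrightarrow> k x *\<^sub>R m x"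
      using conv by eventually_elim (auto intro: tendsto_intros)
    show "AE x in M. norm (u (\<rho> n) x *\<^sub>R m x) \<le> norm (m x)" for n
      using tests_bounds[OF u(1)] by (auto intro!: mult_left_le_one_le)
  qed (use m in auto)
  then have Ek: "E k = E u0" by (simp add: u(2) LIMSEQ_const_iff)
  have "(\<lambda>n. R (u (\<rho> n))) \<longlonglongrightarrow> R k"
    unfolding R_def
  proof (rule integral_dominated_convergence)
    show "AE x in M. (\<lambda>n. u (\<rho> n) x * r x) \<longlonglongrightarrow> k x * r x"
      using conv by eventually_elim (auto intro: tendsto_intros)
    show "AE x in M. norm (u (\<rho> n) x * r x) \<le> norm (r x)" for n
      using tests_bounds[OF u(1)] by (auto simp: abs_mult intro!: mult_left_le_one_le)
  qed (use r in auto)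
  moreover have "(\<lambda>n. v + inverse (real (Suc (\<rho> n)))) \<longlonglongrightarrow> v + 0"
    using LIMSEQ_subseq_LIMSEQ[OF LIMSEQ_inverse_real_of_nat \<rho>(1)]
    by (intro tendsto_add tendsto_const) (simp add: o_def)
  ultimately have "R k \<le> v + 0"
    using u(3) by (intro LIMSEQ_le) (auto intro: less_imp_le)
  moreover have "v \<le> R w" if "w \<in> tests M" "E w = E u0" for w
    unfolding v_def using that by (intro cInf_lower[OF _ bdd]) (auto simp: V_def)
  ultimately have "R k \<le> R w" if "w \<in> tests M" "E w = E u0" for w using that by fastforce
  then show thesis
    using that[OF l, of a] Ek by (simp add: E_def R_def k_def C_def D_def)
qed

section \<open>Gaussian smoothing\<close>

lemma abs_exp_minus_one_minus_le:
  fixes t :: real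
  shows "\<bar>exp t - 1 - t\<bar> \<le> t\<^sup>2 * exp \<bar>t\<bar>"
proof -
  obtain \<xi> where \<xi>: "\<bar>\<xi>\<bar> \<le> \<bar>t\<bar>" "exp t = (\<Sum>m<2. t ^ m / fact m) + exp \<xi> / fact 2 * t ^ 2"
    using Maclaurin_exp_le[of t 2] by auto
  have "exp \<xi> * t\<^sup>2 \<le> exp \<bar>t\<bar> * t\<^sup>2" "0 \<le> exp \<xi> * t\<^sup>2"
    using \<xi>(1) by (auto intro: mult_right_mono)
  moreover have "exp t - 1 - t = exp \<xi> * t\<^sup>2 / 2"
    using \<xi>(2) by (simp add: numeral_2_eq_2)
  ultimately show ?thesis by (subst mult.commute) linarith
qed

text \<open>The gap between the two sides is half the square of
  \<open>exp (p / 2) - exp (q / 2)\<close>, which also settles strictness.\<close>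

lemma exp_midpoint_le:
  fixes p q :: real
  shows "exp ((p + q) / 2) \<le> (exp p + exp q) / 2"
    and "p \<noteq> q \<Longrightarrow> exp ((p + q) / 2) < (exp p + exp q) / 2"
proof -
  have "exp p = exp (p / 2) ^ 2" "exp q = exp (q / 2) ^ 2" by (simp_all flip: exp_double)
  moreover have "exp ((p + q) / 2) = exp (p / 2) * exp (q / 2)"
    by (simp add: add_divide_distrib exp_add)
  ultimately have eq: "(exp p + exp q) / 2 - exp ((p + q) / 2) = (exp (p / 2) - exp (q / 2))\<^sup>2 / 2"
    by (simp add: power2_eq_square field_simps)
  show "exp ((p + q) / 2) \<le> (exp p + exp q) / 2" using eq zero_le_power2[of "exp (p / 2) - exp (q / 2)"] by linarith
  assume "p \<noteq> q"
  then have "0 < (exp (p / 2) - exp (q / 2))\<^sup>2" by simp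
  with eq show "exp ((p + q) / 2) < (exp p + exp q) / 2" by linarith
qed

lemma integrable_exp_minus_square_norm:
  fixes a :: real
  assumes "0 < a"
  shows "integrable lborel (\<lambda>z::'a::euclidean_space. exp (- a * (norm z)\<^sup>2))"
proof -
  \<comment> \<open>The standard deviation with \<open>1 / (2 * s^2) = a\<close>, so that each
    coordinate factor is a multiple of a normal density.\<close>
  define s where "s = sqrt (1 / (2 * a))"
  have s: "0 < s" "s\<^sup>2 = 1 / (2 * a)" using assms by (auto simp: s_def)
  have "(\<lambda>t. exp (- a * t\<^sup>2)) = (\<lambda>t. sqrt (2 * pi * s\<^sup>2) * normal_density 0 s t)"
    using s assms by (auto simp: normal_density_def fun_eq_iff)
  then have "integrable lborel (\<lambda>t. exp (- a * t\<^sup>2))" using s by simp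
  then have fin: "(\<integral>\<^sup>+t. ennreal (exp (- a * t\<^sup>2)) \<partial>lborel) < \<infinity>"
    by (subst nn_integral_eq_integral) auto
  have "ennreal (exp (- a * (norm z)\<^sup>2)) = (\<Prod>b\<in>Basis. ennreal (exp (- a * (z \<bullet> b)\<^sup>2)))" for z :: 'a
  proof -
    have "(norm z)\<^sup>2 = (\<Sum>b\<in>Basis. (z \<bullet> b)\<^sup>2)"
      unfolding power2_norm_eq_inner by (subst euclidean_inner) (simp add: power2_eq_square)
    then show ?thesis by (simp add: prod_ennreal exp_sum[symmetric] sum_distrib_left sum_negf)
  qed
  then have "(\<integral>\<^sup>+z. ennreal (exp (- a * (norm z)\<^sup>2)) \<partial>(lborel :: 'a measure))
      = (\<integral>\<^sup>+z. (\<Prod>b\<in>Basis. ennreal (exp (- a * (z \<bullet> b)\<^sup>2))) \<partial>(lborel :: 'a measure))"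
    by simp
  also have "\<dots> = (\<Prod>b\<in>(Basis::'a set). \<integral>\<^sup>+t. ennreal (exp (- a * t\<^sup>2)) \<partial>lborel)"
    by (rule nn_integral_lborel_prod) auto
  also have "\<dots> < \<infinity>" using fin by (simp add: power_less_top_ennreal)
  finally show ?thesis by (intro integrableI_nonneg) auto
qed

lemma integral_lborel_translation:
  fixes F :: "'a::euclidean_space \<Rightarrow> 'b::{banach, second_countable_topology}"
  assumes [measurable]: "F \<in> borel_measurable borel"
  shows "(\<integral>z. F z \<partial>lborel) = (\<integral>z. F (a + z) \<partial>lborel)"
proof -
  have "(\<integral>z. F z \<partial>lborel) = (\<integral>z. F z \<partial>distr lborel borel ((+) a))"
    by (simp add: lborel_distr_plus)
  also have "\<dots> = (\<integral>z. F (a + z) \<partial>lborel)" by (rule integral_distr) auto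
  finally show ?thesis .
qed

lemma integrable_lborel_translation:
  fixes F :: "'a::euclidean_space \<Rightarrow> 'b::{banach, second_countable_topology}"
  assumes "integrable lborel F"
  shows "integrable lborel (\<lambda>z. F (a + z))"
proof -
  have [measurable]: "F \<in> borel_measurable borel" using assms by auto
  have "integrable (distr lborel borel ((+) a)) F"
    using assms by (simp add: lborel_distr_plus)
  then show ?thesis by (subst (asm) integrable_distr_eq) auto
qed

lemma GDERIV_unique:
  assumes "GDERIV f x :> D" "GDERIV f x :> E"
  shows "D = E"
proof -
  have "(\<lambda>h. inner h D) = (\<lambda>h. inner h E)"
    using assms unfolding gderiv_def by (rule has_derivative_unique)
  then show ?thesis by (metis vector_eq_ldot)
qed

lemma AE_lborel_negligible:
  assumes "negligible {x. P x}"
  shows "AE x in lborel. \<not> P x"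
proof -
  have "AE x in lebesgue. \<not> P x"
    using assms by (intro AE_I'[where N = "{x. P x}"]) (auto simp: negligible_iff_null_sets)
  then show ?thesis by (simp add: AE_completion_iff)
qed

lemma prob_simplex_bounds:
  assumes "p \<in> prob_simplex"
  shows "0 \<le> p $ c" "p $ c \<le> 1"
proof -
  show "0 \<le> p $ c" using assms by (simp add: prob_simplex_def)
  have "p $ c \<le> (\<Sum>i\<in>UNIV. p $ i)"
    using assms by (intro member_le_sum) (auto simp: prob_simplex_def)
  then show "p $ c \<le> 1" using assms by (simp add: prob_simplex_def)
qed

lemma component_in_tests:
  fixes f :: "real ^ 'n \<Rightarrow> real ^ 'y"
  assumes "f \<in> base_classifiers"
  shows "(\<lambda>z. f z $ c) \<in> tests lborel"
proof -
  have "f \<in> borel_measurable borel" using assms by (simp add: base_classifiers_def)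
  then have "(\<lambda>z. f z \<bullet> axis c 1) \<in> borel_measurable borel" by measurable
  then show ?thesis
    using assms prob_simplex_bounds[of "f _" c]
    by (auto simp: tests_def base_classifiers_def inner_axis)
qed

text \<open>The remaining mass \<open>1 - u z\<close> is put on one other class. With a single class
  every component would be constantly 1.\<close>

lemma tests_component:
  fixes u :: "real ^ 'n \<Rightarrow> real" and c :: "'y::finite"
  assumes u: "u \<in> tests lborel" and card: "CARD('y) \<ge> 2"
  obtains f :: "real ^ 'n \<Rightarrow> real ^ 'y" where "f \<in> base_classifiers" "\<And>z. f z $ c = u z"
proof -
  have "(UNIV :: 'y set) \<noteq> {c}"
  proof
    assume "(UNIV :: 'y set) = {c}"
    then have "CARD('y) = card {c}" by (rule arg_cong)
    with card show False by simp
  qed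
  then obtain e :: 'y where e: "e \<noteq> c" by blast
  define f where "f z = u z *\<^sub>R axis c 1 + (1 - u z) *\<^sub>R (axis e 1 :: real ^ 'y)" for z
  have comp: "f z $ i = (if i = c then u z else if i = e then 1 - u z else 0)" for z i
    using e by (simp add: f_def axis_def)
  have "f \<in> base_classifiers"
    unfolding base_classifiers_def
  proof (intro CollectI conjI allI)
    have "u \<in> borel_measurable borel" using tests_measurable[OF u] by simp
    then show "f \<in> borel_measurable borel" unfolding f_def[abs_def] by measurable
    fix z
    have "(\<Sum>i\<in>UNIV. f z $ i) = (\<Sum>i\<in>{c, e}. f z $ i)"
      by (rule sum.mono_neutral_right) (auto simp: comp)
    then show "f z \<in> prob_simplex"
      using e tests_bounds[OF u] by (simp add: prob_simplex_def comp)
  qed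
  then show thesis using that[of f] by (simp add: comp)
qed

locale gaussian =
  fixes \<sigma> :: real and \<mu> :: "real ^ 'n \<Rightarrow> real"
  assumes sigma_pos: "0 < \<sigma>" and mu_def: "\<mu> = gaussian_density \<sigma>"
begin

lemma mu_pos: "0 < \<mu> z"
  using sigma_pos by (simp add: mu_def gaussian_density_def)

lemma mu_nonneg: "0 \<le> \<mu> z"
  using mu_pos[of z] by simp

lemma mu_measurable [measurable]: "\<mu> \<in> borel_measurable borel"
  unfolding mu_def gaussian_density_def[abs_def] by measurable

text \<open>Completing the square gives the likelihood ratio of two Gaussians with the same
  covariance, the source of the exponential in \<open>affine_exp\<close>.\<close>

lemma mu_shift: "\<mu> (z - k) = \<mu> z * exp (z \<bullet> k / \<sigma>\<^sup>2 - (norm k)\<^sup>2 / (2 * \<sigma>\<^sup>2))"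
proof -
  have expand: "(norm (z - k))\<^sup>2 = (norm z)\<^sup>2 - 2 * (z \<bullet> k) + (norm k)\<^sup>2"
    by (simp add: power2_norm_eq_inner algebra_simps inner_commute)
  have "- (norm (z - k))\<^sup>2 / (2 * \<sigma>\<^sup>2)
      = - (norm z)\<^sup>2 / (2 * \<sigma>\<^sup>2) + (z \<bullet> k / \<sigma>\<^sup>2 - (norm k)\<^sup>2 / (2 * \<sigma>\<^sup>2))"
  proof -
    have "- (a - 2 * b + c) / (2 * s) = - a / (2 * s) + (b / s - c / (2 * s))"
      if "s \<noteq> 0" for a b c s :: real
      using that by (simp add: field_simps)
    then show ?thesis unfolding expand using sigma_pos by simp
  qed
  then show ?thesis
    by (simp only: mu_def gaussian_density_def exp_add times_divide_eq_left)
qed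

text \<open>By the parallelogram law, twice the squared norm of the midpoint is at most the sum of
  the squared norms.\<close>

lemma mu_log_concave: "\<mu> y * \<mu> z \<le> (\<mu> ((y + z) /\<^sub>R 2))\<^sup>2"
proof -
  have "(norm ((y + z) /\<^sub>R 2))\<^sup>2 * 4 = (norm (y + z))\<^sup>2" by (simp add: power2_eq_square)
  moreover have "(norm (y + z))\<^sup>2 + (norm (y - z))\<^sup>2 = 2 * (norm y)\<^sup>2 + 2 * (norm z)\<^sup>2"
    by (simp add: power2_norm_eq_inner algebra_simps inner_commute)
  ultimately have mid: "2 * (norm ((y + z) /\<^sub>R 2))\<^sup>2 \<le> (norm y)\<^sup>2 + (norm z)\<^sup>2"
    using zero_le_power2[of "norm (y - z)"] by linarith
  have "- (norm y)\<^sup>2 / (2 * \<sigma>\<^sup>2) + - (norm z)\<^sup>2 / (2 * \<sigma>\<^sup>2)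
      \<le> 2 * (- (norm ((y + z) /\<^sub>R 2))\<^sup>2 / (2 * \<sigma>\<^sup>2))"
  proof -
    have *: "- a / d + - b / d \<le> 2 * (- c / d)" if "2 * c \<le> a + b" "0 < d" for a b c d :: real
      using divide_right_mono[OF that(1), of d] that(2) by (simp add: add_divide_distrib)
    show ?thesis using sigma_pos by (intro *[OF mid]) simp
  qed
  then have "exp (- (norm y)\<^sup>2 / (2 * \<sigma>\<^sup>2)) * exp (- (norm z)\<^sup>2 / (2 * \<sigma>\<^sup>2))
      \<le> (exp (- (norm ((y + z) /\<^sub>R 2))\<^sup>2 / (2 * \<sigma>\<^sup>2)))\<^sup>2"
    by (simp only: exp_add[symmetric] exp_double[symmetric] exp_le_cancel_iff)
  then show ?thesis
    unfolding mu_def gaussian_density_def power_divide times_divide_times_eq power2_eq_square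
    by (intro divide_right_mono) auto
qed

text \<open>Half of the Gaussian exponent absorbs the growing factor: nonnegativity of the square of
  \<open>norm z / (2 * \<sigma>) - L * \<sigma>\<close> bounds \<open>L * norm z\<close> by that
  half plus the constant in \<open>?K\<close>.\<close>

lemma integrable_exp_norm_mu: "integrable lborel (\<lambda>z. exp (L * norm z) * \<mu> z)"
proof (rule Bochner_Integration.integrable_bound)
  let ?K = "exp (L\<^sup>2 * \<sigma>\<^sup>2) / sqrt (2 * pi * \<sigma>\<^sup>2) ^ CARD('n)"
  show "integrable lborel (\<lambda>z::real^'n. ?K * exp (- (1 / (4 * \<sigma>\<^sup>2)) * (norm z)\<^sup>2))"
    using sigma_pos by (intro integrable_mult_right integrable_exp_minus_square_norm) auto
  have "exp (L * norm z) * \<mu> z \<le> ?K * exp (- (1 / (4 * \<sigma>\<^sup>2)) * (norm z)\<^sup>2)" for z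
  proof -
    have "(norm z / (2 * \<sigma>) - L * \<sigma>)\<^sup>2 = (norm z)\<^sup>2 / (4 * \<sigma>\<^sup>2) - L * norm z + L\<^sup>2 * \<sigma>\<^sup>2"
      using sigma_pos by (simp add: power2_eq_square field_simps)
    moreover have "0 \<le> (norm z / (2 * \<sigma>) - L * \<sigma>)\<^sup>2" by simp
    moreover have "- (norm z)\<^sup>2 / (2 * \<sigma>\<^sup>2) = - (2 * ((norm z)\<^sup>2 / (4 * \<sigma>\<^sup>2)))"
      "- (1 / (4 * \<sigma>\<^sup>2)) * (norm z)\<^sup>2 = - ((norm z)\<^sup>2 / (4 * \<sigma>\<^sup>2))" by simp_all
    ultimately have "L * norm z + - (norm z)\<^sup>2 / (2 * \<sigma>\<^sup>2) \<le> L\<^sup>2 * \<sigma>\<^sup>2 + - (1 / (4 * \<sigma>\<^sup>2)) * (norm z)\<^sup>2"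
      by linarith
    then have "exp (L * norm z) * exp (- (norm z)\<^sup>2 / (2 * \<sigma>\<^sup>2))
        \<le> exp (L\<^sup>2 * \<sigma>\<^sup>2) * exp (- (1 / (4 * \<sigma>\<^sup>2)) * (norm z)\<^sup>2)"
      by (simp only: exp_add[symmetric] exp_le_cancel_iff)
    then show ?thesis
      unfolding mu_def gaussian_density_def times_divide_eq_right times_divide_eq_left
      by (rule divide_right_mono) auto
  qed
  then show "AE z in lborel. norm (exp (L * norm z) * \<mu> z)
      \<le> norm (?K * exp (- (1 / (4 * \<sigma>\<^sup>2)) * (norm z)\<^sup>2))"
    using mu_nonneg by simp
qed measurable

lemma integrable_mu: "integrable lborel \<mu>"
  using integrable_exp_norm_mu[of 0] by simp

lemma integrable_mu_shift: "integrable lborel (\<lambda>z. \<mu> (z - k))"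
  using integrable_lborel_translation[OF integrable_mu, of "- k"] by simp

lemma integrable_mu_scaleR: "integrable lborel (\<lambda>z. \<mu> z *\<^sub>R z)"
proof (rule Bochner_Integration.integrable_bound[OF integrable_exp_norm_mu[of 1]])
  have "norm z \<le> exp (norm z)" for z :: "real^'n"
    using exp_ge_add_one_self[of "norm z"] by linarith
  then have "\<mu> z * norm z \<le> \<mu> z * exp (norm z)" for z
    by (intro mult_left_mono mu_nonneg)
  then have "norm (\<mu> z *\<^sub>R z) \<le> norm (exp (1 * norm z) * \<mu> z)" for z
    using mu_nonneg[of z] by (simp add: mult.commute)
  then show "AE z in lborel. norm (\<mu> z *\<^sub>R z) \<le> norm (exp (1 * norm z) * \<mu> z)" by simp
qed measurable

text \<open>The cofactor of \<open>(norm k)\<^sup>2\<close> is integrable, which justifies differentiating under the integral.\<close>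

lemma mu_shift_remainder:
  assumes "norm k \<le> 1"
  shows "\<bar>\<mu> (z - k) - \<mu> z - \<mu> z * (z \<bullet> k / \<sigma>\<^sup>2)\<bar>
    \<le> (norm k)\<^sup>2 * (3 * exp (2 / \<sigma>\<^sup>2) * (exp (2 / \<sigma>\<^sup>2 * norm z) * \<mu> z))"
proof -
  define s where "s = z \<bullet> k / \<sigma>\<^sup>2"
  define q where "q = (norm k)\<^sup>2 / (2 * \<sigma>\<^sup>2)"
  \<comment> \<open>One quantity controls both parts of the exponent: \<open>s - q\<close> is
    bounded by \<open>norm k * A\<close> and \<open>q\<close> by
    \<open>(norm k)^2 * A\<close>.\<close>
  define A where "A = (norm z + 1) / \<sigma>\<^sup>2"
  have s2: "0 < \<sigma>\<^sup>2" using sigma_pos by simp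
  have A: "0 \<le> A" using s2 by (simp add: A_def)
  have k2: "(norm k)\<^sup>2 \<le> norm k" using assms by (simp add: power2_eq_square mult_left_le)
  have q: "0 \<le> q" "q \<le> (norm k)\<^sup>2 * A"
  proof -
    show "0 \<le> q" by (simp add: q_def)
    have "(norm k)\<^sup>2 * (1 / 2) \<le> (norm k)\<^sup>2 * (norm z + 1)" by (rule mult_left_mono) (auto intro: order_trans[of _ 1])
    then show "q \<le> (norm k)\<^sup>2 * A" using s2 by (simp add: q_def A_def field_simps)
  qed
  have t: "\<bar>s - q\<bar> \<le> norm k * A"
  proof -
    have "\<bar>z \<bullet> k\<bar> \<le> norm z * norm k" by (rule Cauchy_Schwarz_ineq2)
    then have "\<bar>s\<bar> \<le> norm k * (norm z / \<sigma>\<^sup>2)" using s2 by (simp add: s_def abs_divide divide_right_mono mult.commute)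
    moreover have "(norm k)\<^sup>2 \<le> norm k * 2" by (rule order_trans[OF k2]) simp
    then have "q \<le> norm k * (1 / \<sigma>\<^sup>2)" using s2 by (simp add: q_def field_simps)
    moreover have "norm k * A = norm k * (norm z / \<sigma>\<^sup>2) + norm k * (1 / \<sigma>\<^sup>2)"
      by (simp add: A_def add_divide_distrib algebra_simps)
    ultimately show ?thesis using q by linarith
  qed
  have eA: "A \<le> exp A" "A\<^sup>2 \<le> 2 * exp A"
  proof -
    show "A \<le> exp A" using exp_ge_add_one_self[of A] by linarith
    show "A\<^sup>2 \<le> 2 * exp A"
      using exp_lower_Taylor_quadratic[OF A] A by simp
  qed
  have tA: "\<bar>s - q\<bar> \<le> A" using t assms A by (meson mult_left_le_one_le norm_ge_zero order_trans)
  have "\<bar>exp (s - q) - 1 - s\<bar> \<le> \<bar>exp (s - q) - 1 - (s - q)\<bar> + q" using q by linarith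
  also have "\<dots> \<le> (s - q)\<^sup>2 * exp \<bar>s - q\<bar> + q"
    using abs_exp_minus_one_minus_le[of "s - q"] by simp
  also have "\<dots> \<le> (norm k * A)\<^sup>2 * exp A + (norm k)\<^sup>2 * A"
  proof (intro add_mono mult_mono q)
    show "(s - q)\<^sup>2 \<le> (norm k * A)\<^sup>2" using t by (metis abs_ge_zero power2_abs power_mono)
  qed (use tA in auto)
  also have "\<dots> = (norm k)\<^sup>2 * (A\<^sup>2 * exp A + A)" by (simp add: power_mult_distrib algebra_simps)
  \<comment> \<open>Powers of \<open>A\<close> are absorbed into exponentials. The coefficients 2
    and 1 add up to the factor 3, and \<open>exp (2 * A)\<close> splits into the two exponentials of
    the statement.\<close>
  also have "\<dots> \<le> (norm k)\<^sup>2 * (2 * exp A * exp A + exp A * exp A)"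
  proof (intro mult_left_mono add_mono mult_right_mono eA)
    show "A \<le> exp A * exp A" using eA(1) A by (smt (verit) mult_le_cancel_left1 exp_gt_zero one_le_exp_iff)
  qed auto
  also have "\<dots> = (norm k)\<^sup>2 * (3 * exp (2 * A))" by (simp add: exp_double power2_eq_square)
  also have "2 * A = 2 / \<sigma>\<^sup>2 + 2 / \<sigma>\<^sup>2 * norm z" by (simp add: A_def add_divide_distrib)
  finally have "\<bar>exp (s - q) - 1 - s\<bar> \<le> (norm k)\<^sup>2 * (3 * (exp (2 / \<sigma>\<^sup>2) * exp (2 / \<sigma>\<^sup>2 * norm z)))"
    by (simp add: exp_add)
  then have "\<mu> z * \<bar>exp (s - q) - 1 - s\<bar> \<le> \<mu> z * ((norm k)\<^sup>2 * (3 * (exp (2 / \<sigma>\<^sup>2) * exp (2 / \<sigma>\<^sup>2 * norm z))))"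
    by (rule mult_left_mono[OF _ mu_nonneg])
  moreover have "\<mu> (z - k) - \<mu> z - \<mu> z * (z \<bullet> k / \<sigma>\<^sup>2) = \<mu> z * (exp (s - q) - 1 - s)"
    by (simp add: mu_shift s_def q_def algebra_simps)
  ultimately show ?thesis using mu_nonneg[of z] by (simp add: abs_mult mult_ac)
qed

text \<open>The shift sits on the density, whereas smoothing by \<open>\<star>\<close> shifts the
  classifier. As \<open>u\<close> is merely measurable, dependence on \<open>k\<close> has to be
  carried by the smooth factor; moreover \<open>\<mu> (z - k)\<close> becomes a fixed weight against
  which \<open>u\<close> is integrated, as the Neyman-Pearson lemma expects.\<close>

definition smooth1 :: "(real ^ 'n \<Rightarrow> real) \<Rightarrow> real ^ 'n \<Rightarrow> real" where
  "smooth1 u k = (\<integral>z. \<mu> (z - k) * u z \<partial>lborel)"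

lemma smooth1_translate:
  assumes [measurable]: "u \<in> borel_measurable borel"
  shows "smooth1 u (x + k) = smooth1 (\<lambda>z. u (x + z)) k"
  unfolding smooth1_def
  by (subst integral_lborel_translation[where a = x]) (auto simp: algebra_simps)

lemma integrable_smooth1:
  assumes "u \<in> tests lborel"
  shows "integrable lborel (\<lambda>z. \<mu> (z - k) * u z)"
  using integrable_tests_scaleR[OF assms integrable_mu_shift[of k]] by (simp add: mult.commute)

lemma tests_translate:
  "u \<in> tests lborel \<Longrightarrow> (\<lambda>z. u (x + z)) \<in> tests lborel" for x :: "real ^ 'n"
  by (auto simp: tests_def)

text \<open>A form of Stein's identity. Translation reduces it to the origin, where
  \<open>mu_shift_remainder\<close> integrates to an error of order \<open>(norm k)^2\<close>,
  uniformly because a test is bounded by 1.\<close>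

lemma GDERIV_smooth1:
  assumes u: "u \<in> tests lborel"
  shows "GDERIV (smooth1 u) x :> (1 / \<sigma>\<^sup>2) *\<^sub>R (\<integral>z. u (x + z) *\<^sub>R (\<mu> z *\<^sub>R z) \<partial>lborel)"
proof -
  have [measurable]: "u \<in> borel_measurable borel" using tests_measurable[OF u] by simp
  define w where "w z = u (x + z)" for z
  have w: "w \<in> tests lborel" unfolding w_def[abs_def] using u by (rule tests_translate)
  have [measurable]: "w \<in> borel_measurable borel" using tests_measurable[OF w] by simp
  define D where "D = (1 / \<sigma>\<^sup>2) *\<^sub>R (\<integral>z. w z *\<^sub>R (\<mu> z *\<^sub>R z) \<partial>lborel)"
  define B where "B z = 3 * exp (2 / \<sigma>\<^sup>2) * (exp (2 / \<sigma>\<^sup>2 * norm z) * \<mu> z)" for z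
  have iB: "integrable lborel B"
    unfolding B_def by (intro integrable_mult_right integrable_exp_norm_mu)
  have iD: "integrable lborel (\<lambda>z. w z *\<^sub>R (\<mu> z *\<^sub>R z))"
    by (rule integrable_tests_scaleR[OF w integrable_mu_scaleR])
  have bound: "\<bar>smooth1 w k - smooth1 w 0 - k \<bullet> D\<bar> \<le> (norm k)\<^sup>2 * (\<integral>z. B z \<partial>lborel)"
    if k: "norm k \<le> 1" for k
  proof -
    have i1: "integrable lborel (\<lambda>z. \<mu> (z - k) * w z)" "integrable lborel (\<lambda>z. \<mu> z * w z)"
      using integrable_smooth1[OF w, of k] integrable_smooth1[OF w, of 0] by simp_all
    have eq: "\<mu> z * (z \<bullet> k / \<sigma>\<^sup>2) * w z = (k \<bullet> (w z *\<^sub>R (\<mu> z *\<^sub>R z))) * (1 / \<sigma>\<^sup>2)" for z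
      by (simp add: inner_commute)
    have i2: "integrable lborel (\<lambda>z. \<mu> z * (z \<bullet> k / \<sigma>\<^sup>2) * w z)"
      unfolding eq by (intro integrable_mult_left integrable_inner_right iD)
    have "k \<bullet> D = (\<integral>z. \<mu> z * (z \<bullet> k / \<sigma>\<^sup>2) * w z \<partial>lborel)"
      unfolding eq D_def using iD by (simp del: inner_scaleR_right add: inner_scaleR_right[of k "1 / \<sigma>\<^sup>2"])
    then have "smooth1 w k - smooth1 w 0 - k \<bullet> D
        = (\<integral>z. (\<mu> (z - k) * w z - \<mu> z * w z) - \<mu> z * (z \<bullet> k / \<sigma>\<^sup>2) * w z \<partial>lborel)"
      unfolding smooth1_def using i1 i2 by simp
    also have "\<bar>\<dots>\<bar> \<le> (\<integral>z. (norm k)\<^sup>2 * B z \<partial>lborel)"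
    proof (rule order_trans[OF integral_abs_bound], rule integral_mono)
      fix z
      have "\<bar>(\<mu> (z - k) - \<mu> z - \<mu> z * (z \<bullet> k / \<sigma>\<^sup>2)) * w z\<bar> \<le> \<bar>\<mu> (z - k) - \<mu> z - \<mu> z * (z \<bullet> k / \<sigma>\<^sup>2)\<bar> * 1"
        unfolding abs_mult using tests_bounds[OF w, of z] by (intro mult_left_mono) auto
      also have "\<dots> \<le> (norm k)\<^sup>2 * B z" using mu_shift_remainder[OF k] by (simp add: B_def)
      finally show "\<bar>(\<mu> (z - k) * w z - \<mu> z * w z) - \<mu> z * (z \<bullet> k / \<sigma>\<^sup>2) * w z\<bar> \<le> (norm k)\<^sup>2 * B z"
        by (simp add: algebra_simps)
    qed (use i1 i2 iB in auto)
    finally show ?thesis using iB by simp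
  qed
  have sm: "smooth1 u y = smooth1 w (y - x)" for y
    using smooth1_translate[of u x "y - x"] by (simp add: w_def[abs_def])
  have "(smooth1 u has_derivative (\<lambda>h. h \<bullet> D)) (at x)"
  proof (rule has_derivativeI_sandwich[where e = 1 and H = "\<lambda>y. norm (y - x) * (\<integral>z. B z \<partial>lborel)"])
    show "bounded_linear (\<lambda>h. h \<bullet> D)" by (rule bounded_linear_inner_left)
    have "((\<lambda>y. norm (y - x) * (\<integral>z. B z \<partial>lborel)) \<longlongrightarrow> norm (x - x) * (\<integral>z. B z \<partial>lborel)) (at x)"
      by (intro tendsto_intros)
    then show "((\<lambda>y. norm (y - x) * (\<integral>z. B z \<partial>lborel)) \<longlongrightarrow> 0) (at x)" by simp
    fix y assume y: "y \<noteq> x" "dist y x < 1"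
    have "\<bar>smooth1 w (y - x) - smooth1 w 0 - (y - x) \<bullet> D\<bar> \<le> (norm (y - x))\<^sup>2 * (\<integral>z. B z \<partial>lborel)"
      using y by (intro bound) (simp add: dist_norm)
    then show "norm (smooth1 u y - smooth1 u x - (y - x) \<bullet> D) / norm (y - x) \<le> norm (y - x) * (\<integral>z. B z \<partial>lborel)"
      using y by (simp add: sm field_simps power2_eq_square)
  qed auto
  then show ?thesis by (simp add: gderiv_def D_def w_def)
qed

lemma continuous_smooth1:
  assumes "u \<in> tests lborel"
  shows "continuous_on UNIV (smooth1 u)"
  by (intro continuous_at_imp_continuous_on ballI)
     (rule has_derivative_continuous[OF GDERIV_smooth1[OF assms, unfolded gderiv_def]])

text \<open>Prekopa-Leindler is applied to shifted densities cut off to \<open>C\<close>. Points and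
  shifts average together, so its hypothesis splits into convexity of \<open>C\<close> and
  log-concavity of \<open>\<mu>\<close>.\<close>

lemma smooth1_indicator_log_concave:
  fixes C :: "(real ^ 'n) set"
  assumes [measurable]: "C \<in> sets borel" and C: "convex C"
  shows "smooth1 (indicator C) j * smooth1 (indicator C) k \<le> (smooth1 (indicator C) ((j + k) /\<^sub>R 2))\<^sup>2"
proof -
  let ?s = "smooth1 (indicator C)"
  have nonneg: "0 \<le> \<mu> (z - k) * indicator C z" for z k
    using mu_nonneg by (simp add: indicator_def)
  have nonneg': "0 \<le> ?s k" for k unfolding smooth1_def by (intro Bochner_Integration.integral_nonneg nonneg)
  have eq: "ennreal (?s k) = (\<integral>\<^sup>+z. ennreal (\<mu> (z - k) * indicator C z) \<partial>lborel)" for k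
    unfolding smooth1_def
    using integrable_smooth1[OF indicator_in_tests, of C k] nonneg
    by (subst nn_integral_eq_integral) auto
  have "ennreal (?s j) * ennreal (?s k) \<le> (ennreal (?s ((j + k) /\<^sub>R 2)))\<^sup>2"
    unfolding eq
  proof (rule prekopa_leindler_midpoint)
    fix y z
    have "\<mu> (y - j) * indicator C y * (\<mu> (z - k) * indicator C z)
        \<le> (\<mu> ((y + z) /\<^sub>R 2 - (j + k) /\<^sub>R 2) * indicator C ((y + z) /\<^sub>R 2))\<^sup>2"
    proof (cases "y \<in> C \<and> z \<in> C")
      case True
      then have "(1 / 2) *\<^sub>R y + (1 / 2) *\<^sub>R z \<in> C" using convexD[OF C, of y z "1 / 2" "1 / 2"] by simp
      then have "(y + z) /\<^sub>R 2 \<in> C" by (simp add: scaleR_add_right)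
      moreover have "(y + z) /\<^sub>R 2 - (j + k) /\<^sub>R 2 = ((y - j) + (z - k)) /\<^sub>R 2"
        by (simp add: algebra_simps)
      ultimately show ?thesis using True mu_log_concave[of "y - j" "z - k"] by simp
    qed auto
    then show "ennreal (\<mu> (y - j) * indicator C y) * ennreal (\<mu> (z - k) * indicator C z)
      \<le> (ennreal (\<mu> ((y + z) /\<^sub>R 2 - (j + k) /\<^sub>R 2) * indicator C ((y + z) /\<^sub>R 2)))\<^sup>2"
      using nonneg by (simp add: ennreal_mult[symmetric] ennreal_power ennreal_leI)
  qed measurable
  then show ?thesis using nonneg' by (simp add: ennreal_mult[symmetric] ennreal_power)
qed

lemma convex_smooth1_indicator_superlevel:
  fixes C :: "(real ^ 'n) set"
  assumes [measurable]: "C \<in> sets borel" and C: "convex C" and s: "0 \<le> s"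
  shows "convex {k. s \<le> smooth1 (indicator C) k}"
proof (rule closed_midpoint_imp_convex)
  have t: "indicator C \<in> tests lborel" by (rule indicator_in_tests) simp
  show "closed {k. s \<le> smooth1 (indicator C) k}"
    by (intro closed_Collect_le continuous_on_const continuous_smooth1[OF t])
  fix j k assume jk: "j \<in> {k. s \<le> smooth1 (indicator C) k}" "k \<in> {k. s \<le> smooth1 (indicator C) k}"
  have "0 \<le> smooth1 (indicator C) ((j + k) /\<^sub>R 2)"
    unfolding smooth1_def using mu_nonneg by (intro Bochner_Integration.integral_nonneg) (auto simp: indicator_def)
  moreover have "s\<^sup>2 \<le> smooth1 (indicator C) j * smooth1 (indicator C) k"
    unfolding power2_eq_square using jk s by (intro mult_mono) auto
  then have "s\<^sup>2 \<le> (smooth1 (indicator C) ((j + k) /\<^sub>R 2))\<^sup>2"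
    using smooth1_indicator_log_concave[OF assms(1) C, of j k] by linarith
  ultimately show "(j + k) /\<^sub>R 2 \<in> {k. s \<le> smooth1 (indicator C) k}"
    using power2_le_imp_le by blast
qed


section \<open>Convex minimizers for the first-order constraints\<close>

lemma smooth_component:
  assumes f: "f \<in> base_classifiers"
  shows "(f \<star> \<mu>) k $ c = smooth1 (\<lambda>z. f z $ c) k"
proof -
  have f': "(\<lambda>z. f (k + z) $ c) \<in> tests lborel" for c
    using tests_translate[OF component_in_tests[OF f]] .
  have [measurable]: "f \<in> borel_measurable borel" using f by (simp add: base_classifiers_def)
  have "integrable lborel (\<lambda>z. \<mu> z *\<^sub>R f (k + z))"
  proof (rule Bochner_Integration.integrable_bound)
    show "integrable lborel (\<lambda>z. real CARD('a) * \<mu> z)"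
      by (intro integrable_mult_right integrable_mu)
    have "norm (\<mu> z *\<^sub>R f (k + z)) \<le> norm (real CARD('a) * \<mu> z)" for z
    proof -
      have "norm (f (k + z)) \<le> (\<Sum>i\<in>UNIV. \<bar>f (k + z) $ i\<bar>)" by (rule norm_le_l1_cart)
      also have "\<dots> \<le> (\<Sum>i\<in>(UNIV::'a set). 1)"
        using tests_bounds[OF f', of z] by (intro sum_mono) auto
      finally have "\<mu> z * norm (f (k + z)) \<le> \<mu> z * real CARD('a)"
        by (intro mult_left_mono mu_nonneg) simp
      then show ?thesis using mu_nonneg[of z] by (simp add: mult.commute)
    qed
    then show "AE z in lborel. norm (\<mu> z *\<^sub>R f (k + z)) \<le> norm (real CARD('a) * \<mu> z)" by simp
  qed measurable
  then have "(f \<star> \<mu>) k $ c = (\<integral>z. (\<mu> z *\<^sub>R f (k + z)) $ c \<partial>lborel)"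
    unfolding smooth_def by (rule integral_bounded_linear[OF bounded_linear_vec_nth, symmetric])
  also have "\<dots> = smooth1 (\<lambda>z. f (k + z) $ c) 0" by (simp add: smooth1_def)
  also have "\<dots> = smooth1 (\<lambda>z. f z $ c) (k + 0)"
    using tests_measurable[OF component_in_tests[OF f]] by (intro smooth1_translate[symmetric]) simp
  finally show ?thesis by simp
qed

text \<open>
  After translating \<open>x\<close> to the origin, prescribing \<open>y0\<close> and \<open>y1\<close> amounts to prescribing \<open>moments\<close>.
\<close>

definition moment :: "real ^ 'n \<Rightarrow> real \<times> (real ^ 'n)" where
  "moment z = (\<mu> z, \<mu> z *\<^sub>R z)"

definition moments :: "(real ^ 'n \<Rightarrow> real) \<Rightarrow> real \<times> (real ^ 'n)" where
  "moments u = (\<integral>z. u z *\<^sub>R moment z \<partial>lborel)"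

lemma integrable_moment: "integrable lborel moment"
proof -
  have "integrable lborel (\<lambda>z. (\<mu> z, 0 :: real ^ 'n) + (0, \<mu> z *\<^sub>R z))"
    by (intro Bochner_Integration.integrable_add
        integrable_bounded_linear[OF bounded_linear_Pair[OF bounded_linear_ident bounded_linear_zero] integrable_mu]
        integrable_bounded_linear[OF bounded_linear_Pair[OF bounded_linear_zero bounded_linear_ident] integrable_mu_scaleR])
  then show ?thesis by (simp add: moment_def[abs_def])
qed

lemma moments_eq:
  assumes "u \<in> tests lborel"
  shows "moments u = (smooth1 u 0, (\<integral>z. u z *\<^sub>R (\<mu> z *\<^sub>R z) \<partial>lborel))"
proof -
  have i: "integrable lborel (\<lambda>z. u z *\<^sub>R moment z)"
    by (rule integrable_tests_scaleR[OF assms integrable_moment])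
  have "fst (moments u) = smooth1 u 0"
    unfolding moments_def smooth1_def
    by (subst integral_bounded_linear[OF bounded_linear_fst i, symmetric])
       (simp add: moment_def mult.commute)
  moreover have "snd (moments u) = (\<integral>z. u z *\<^sub>R (\<mu> z *\<^sub>R z) \<partial>lborel)"
    unfolding moments_def
    by (subst integral_bounded_linear[OF bounded_linear_snd i, symmetric]) (simp add: moment_def)
  ultimately show ?thesis by (metis prod.collapse)
qed

text \<open>A smoothed component always has a gradient, namely a scaled first moment. By uniqueness
  of gradients the derivative condition is therefore an equation between first moments.\<close>

lemma local_information_iff_moments:
  assumes f: "f \<in> base_classifiers"
    and y0: "y0 = smooth1 u 0" and y1: "y1 = (1 / \<sigma>\<^sup>2) *\<^sub>R (\<integral>z. u z *\<^sub>R (\<mu> z *\<^sub>R z) \<partial>lborel)"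
    and u: "u \<in> tests lborel"
  shows "(f \<star> \<mu>) x $ c = y0 \<and> GDERIV (\<lambda>k. (f \<star> \<mu>) k $ c) x :> y1
    \<longleftrightarrow> moments (\<lambda>z. f (x + z) $ c) = moments u"
proof -
  let ?v = "\<lambda>z. f (x + z) $ c"
  have t: "(\<lambda>z. f z $ c) \<in> tests lborel" by (rule component_in_tests[OF f])
  have v: "?v \<in> tests lborel" by (rule tests_translate[OF t])
  have "(f \<star> \<mu>) x $ c = smooth1 ?v 0"
    using smooth1_translate[of "\<lambda>z. f z $ c" x 0] tests_measurable[OF t] smooth_component[OF f] by simp
  moreover have "GDERIV (\<lambda>k. (f \<star> \<mu>) k $ c) x :> (1 / \<sigma>\<^sup>2) *\<^sub>R (\<integral>z. ?v z *\<^sub>R (\<mu> z *\<^sub>R z) \<partial>lborel)"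
    using GDERIV_smooth1[OF t, of x] unfolding smooth_component[OF f] .
  then have "GDERIV (\<lambda>k. (f \<star> \<mu>) k $ c) x :> y1
    \<longleftrightarrow> (1 / \<sigma>\<^sup>2) *\<^sub>R (\<integral>z. ?v z *\<^sub>R (\<mu> z *\<^sub>R z) \<partial>lborel) = y1"
    using GDERIV_unique by blast
  ultimately show ?thesis
    using sigma_pos unfolding moments_eq[OF v] moments_eq[OF u] y0 y1 by auto
qed

section \<open>Multiplier functions, their sublevel sets and their null sets\<close>

text \<open>The multiplier combination of the constraints and the objective, divided by the positive
  density \<open>\<mu> z\<close>; see \<open>moment_combination\<close>. For
  \<open>l \<ge> 0\<close> it is affine plus convex.\<close>

definition affine_exp :: "real \<Rightarrow> real ^ 'n \<Rightarrow> real \<Rightarrow> real ^ 'n \<Rightarrow> real ^ 'n \<Rightarrow> real" where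
  "affine_exp a b l \<delta> z = a + b \<bullet> z + l * exp (z \<bullet> \<delta> / \<sigma>\<^sup>2 - (norm \<delta>)\<^sup>2 / (2 * \<sigma>\<^sup>2))"

lemma moment_combination:
  "(a, b) \<bullet> moment z + l * \<mu> (z - \<delta>) = \<mu> z * affine_exp a b l \<delta> z"
  by (simp add: moment_def inner_Pair affine_exp_def mu_shift algebra_simps)

lemma affine_exp_midpoint:
  assumes l: "0 \<le> l"
  shows "affine_exp a b l \<delta> ((y + z) /\<^sub>R 2) \<le> (affine_exp a b l \<delta> y + affine_exp a b l \<delta> z) / 2"
    and "0 < l \<Longrightarrow> y \<bullet> \<delta> \<noteq> z \<bullet> \<delta> \<Longrightarrow>
      affine_exp a b l \<delta> ((y + z) /\<^sub>R 2) < (affine_exp a b l \<delta> y + affine_exp a b l \<delta> z) / 2"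
proof -
  define e where "e z = z \<bullet> \<delta> / \<sigma>\<^sup>2 - (norm \<delta>)\<^sup>2 / (2 * \<sigma>\<^sup>2)" for z
  have e: "e ((y + z) /\<^sub>R 2) = (e y + e z) / 2"
    using sigma_pos by (simp add: e_def inner_add_left field_simps)
  have eq: "(affine_exp a b l \<delta> y + affine_exp a b l \<delta> z) / 2 - affine_exp a b l \<delta> ((y + z) /\<^sub>R 2)
      = l * ((exp (e y) + exp (e z)) / 2 - exp ((e y + e z) / 2))"
    unfolding affine_exp_def e_def[symmetric] e by (simp add: inner_add_right field_simps)
  have "0 \<le> l * ((exp (e y) + exp (e z)) / 2 - exp ((e y + e z) / 2))"
    using l exp_midpoint_le(1)[of "e y" "e z"] by (intro mult_nonneg_nonneg) auto
  then show "affine_exp a b l \<delta> ((y + z) /\<^sub>R 2) \<le> (affine_exp a b l \<delta> y + affine_exp a b l \<delta> z) / 2"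
    using eq by linarith
  assume "0 < l" "y \<bullet> \<delta> \<noteq> z \<bullet> \<delta>"
  then have "e y \<noteq> e z" using sigma_pos by (simp add: e_def)
  then have "0 < l * ((exp (e y) + exp (e z)) / 2 - exp ((e y + e z) / 2))"
    using \<open>0 < l\<close> exp_midpoint_le(2)[of "e y" "e z"] by (intro mult_pos_pos) auto
  then show "affine_exp a b l \<delta> ((y + z) /\<^sub>R 2) < (affine_exp a b l \<delta> y + affine_exp a b l \<delta> z) / 2"
    using eq by linarith
qed

lemma continuous_affine_exp: "continuous_on UNIV (affine_exp a b l \<delta>)"
  unfolding affine_exp_def[abs_def] using sigma_pos by (intro continuous_intros) auto

lemma convex_affine_exp_nonpos:
  assumes "0 \<le> l"
  shows "convex {z. affine_exp a b l \<delta> z \<le> 0}"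
proof (rule closed_midpoint_imp_convex)
  show "closed {z. affine_exp a b l \<delta> z \<le> 0}"
    by (intro closed_Collect_le continuous_on_const continuous_affine_exp)
  fix y z assume "y \<in> {z. affine_exp a b l \<delta> z \<le> 0}" "z \<in> {z. affine_exp a b l \<delta> z \<le> 0}"
  then show "(y + z) /\<^sub>R 2 \<in> {z. affine_exp a b l \<delta> z \<le> 0}"
    by (intro CollectI order_trans[OF affine_exp_midpoint(1)[OF assms]]) simp
qed

text \<open>The strict sublevel set need not be closed, so the midpoint criterion does not apply
  directly. Any two of its points lie in the closed sublevel set at their larger value
  \<open>m < 0\<close>, and lowering the constant \<open>a\<close> by \<open>m\<close> moves that
  level to 0.\<close>

lemma convex_affine_exp_neg:
  assumes "0 \<le> l"
  shows "convex {z. affine_exp a b l \<delta> z < 0}"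
proof (rule convexI)
  fix y z and s t :: real
  assume yz: "y \<in> {z. affine_exp a b l \<delta> z < 0}" "z \<in> {z. affine_exp a b l \<delta> z < 0}"
    and st: "0 \<le> s" "0 \<le> t" "s + t = 1"
  define m where "m = max (affine_exp a b l \<delta> y) (affine_exp a b l \<delta> z)"
  have shift: "affine_exp (a - m) b l \<delta> w \<le> 0 \<longleftrightarrow> affine_exp a b l \<delta> w \<le> m" for w
    by (auto simp: affine_exp_def)
  have "s *\<^sub>R y + t *\<^sub>R z \<in> {w. affine_exp (a - m) b l \<delta> w \<le> 0}"
    by (rule convexD[OF convex_affine_exp_nonpos[OF assms] _ _ st])
       (simp_all only: mem_Collect_eq shift, simp_all add: m_def)
  then have "affine_exp a b l \<delta> (s *\<^sub>R y + t *\<^sub>R z) \<le> m" by (simp only: mem_Collect_eq shift)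
  then show "s *\<^sub>R y + t *\<^sub>R z \<in> {z. affine_exp a b l \<delta> z < 0}"
    using yz by (auto simp: m_def)
qed

text \<open>For \<open>l > 0\<close> a zero cannot be interior to the closed sublevel set: moving
  from it both ways along \<delta> would give two nonpositive values, and strict convexity in that
  direction would make the value between them negative. So zeros lie on the frontier of a convex
  set, which is null. With \<delta> = 0 the choice \<open>b = 0\<close>, \<open>a = - l\<close>
  gives the zero function.\<close>

lemma negligible_affine_exp_zero:
  assumes l: "0 \<le> l" and \<delta>: "\<delta> \<noteq> 0" and nz: "((a, b), l) \<noteq> 0"
  shows "negligible {z. affine_exp a b l \<delta> z = 0}"
proof (cases "l = 0")
  case True
  then have "b \<noteq> 0 \<or> - a \<noteq> 0" using nz by (auto simp: zero_prod_def)
  then have "negligible {z. b \<bullet> z = - a}" by (rule negligible_hyperplane)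
  moreover have "{z. affine_exp a b l \<delta> z = 0} = {z. b \<bullet> z = - a}"
    using True by (auto simp: affine_exp_def)
  ultimately show ?thesis by simp
next
  case False
  with l have l: "0 < l" by simp
  let ?S = "{z. affine_exp a b l \<delta> z \<le> 0}"
  have "z \<in> frontier ?S" if z: "affine_exp a b l \<delta> z = 0" for z
  proof (rule ccontr)
    assume "z \<notin> frontier ?S"
    then have "z \<in> interior ?S" using z closure_subset[of ?S, THEN subsetD, of z] by (simp add: frontier_def)
    then obtain e where e: "0 < e" "cball z e \<subseteq> ?S" by (auto simp: mem_interior_cball)
    define v where "v = (e / norm \<delta>) *\<^sub>R \<delta>"
    have "norm v = e" using \<delta> e(1) by (simp add: v_def)
    then have "z + v \<in> cball z e" "z - v \<in> cball z e" by (simp_all add: dist_norm)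
    then have "affine_exp a b l \<delta> (z + v) \<le> 0" "affine_exp a b l \<delta> (z - v) \<le> 0" using e(2) by blast+
    moreover have "(z + v) \<bullet> \<delta> \<noteq> (z - v) \<bullet> \<delta>"
      using \<delta> e(1) by (simp add: v_def inner_add_left inner_diff_left)
    then have "affine_exp a b l \<delta> (((z + v) + (z - v)) /\<^sub>R 2) < (affine_exp a b l \<delta> (z + v) + affine_exp a b l \<delta> (z - v)) / 2"
      using l by (intro affine_exp_midpoint(2)) auto
    moreover have "((z + v) + (z - v)) /\<^sub>R 2 = z" by (simp add: scaleR_2[symmetric])
    ultimately show False using z by simp
  qed
  then have "{z. affine_exp a b l \<delta> z = 0} \<subseteq> frontier ?S" by blast
  then show ?thesis
    using negligible_convex_frontier[OF convex_affine_exp_nonpos] l by (meson less_imp_le negligible_subset)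
qed

lemma convex_minimizer:
  assumes u: "u \<in> tests lborel" and \<delta>: "\<delta> \<noteq> 0"
  obtains C where "C \<in> sets borel" "convex C" "moments (indicator C) = moments u"
    "\<And>v. v \<in> tests lborel \<Longrightarrow> moments v = moments u \<Longrightarrow> smooth1 (indicator C) \<delta> \<le> smooth1 v \<delta>"
proof -
  have nd: "AE z in lborel. p \<bullet> moment z + l * \<mu> (z - \<delta>) \<noteq> 0" if "0 \<le> l" "(p, l) \<noteq> 0" for p l
  proof (cases p)
    case (Pair a b)
    have "AE z in lborel. affine_exp a b l \<delta> z \<noteq> 0"
      using that Pair by (intro AE_lborel_negligible negligible_affine_exp_zero \<delta>) auto
    then have "AE z in lborel. \<mu> z * affine_exp a b l \<delta> z \<noteq> 0"
      by eventually_elim (simp add: less_imp_neq[OF mu_pos, symmetric])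
    then show ?thesis unfolding Pair moment_combination .
  qed
  obtain p l where l: "0 \<le> l" and
    m: "(\<integral>z. indicator {z \<in> space lborel. p \<bullet> moment z + l * \<mu> (z - \<delta>) < 0} z *\<^sub>R moment z \<partial>lborel) = (\<integral>z. u z *\<^sub>R moment z \<partial>lborel)" and
    r: "\<And>v. v \<in> tests lborel \<Longrightarrow> (\<integral>z. v z *\<^sub>R moment z \<partial>lborel) = (\<integral>z. u z *\<^sub>R moment z \<partial>lborel) \<Longrightarrow>
      (\<integral>z. indicator {z \<in> space lborel. p \<bullet> moment z + l * \<mu> (z - \<delta>) < 0} z * \<mu> (z - \<delta>) \<partial>lborel) \<le> (\<integral>z. v z * \<mu> (z - \<delta>) \<partial>lborel)"
    by (rule neyman_pearson_minimizer[where m = moment and r = "\<lambda>z. \<mu> (z - \<delta>)",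
          OF integrable_moment integrable_mu_shift u nd]) blast+
  obtain a b where p: "p = (a, b)" by (cases p)
  define C where "C = {z. affine_exp a b l \<delta> z < 0}"
  have C: "{z \<in> space lborel. p \<bullet> moment z + l * \<mu> (z - \<delta>) < 0} = C"
    unfolding p moment_combination C_def by (simp add: mult_less_0_iff mu_pos mu_nonneg[THEN leD])
  have s: "smooth1 w \<delta> = (\<integral>z. w z * \<mu> (z - \<delta>) \<partial>lborel)" for w
    unfolding smooth1_def by (intro Bochner_Integration.integral_cong refl mult.commute)
  show thesis
  proof (rule that[of C])
    show "C \<in> sets borel" unfolding C_def
      by (intro borel_open open_Collect_less continuous_affine_exp continuous_on_const)
    show "convex C" unfolding C_def by (rule convex_affine_exp_neg[OF l])
    show "moments (indicator C) = moments u" using m unfolding C moments_def .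
    show "smooth1 (indicator C) \<delta> \<le> smooth1 v \<delta>" if "v \<in> tests lborel" "moments v = moments u" for v
      using r[OF that(1) that(2)[unfolded moments_def]] unfolding C s .
  qed
qed

lemma smooth1_zero_eq:
  assumes "u \<in> tests lborel" "v \<in> tests lborel" "moments u = moments v"
  shows "smooth1 u 0 = smooth1 v 0"
  using arg_cong[OF assms(3), of fst] by (simp only: moments_eq[OF assms(1)] moments_eq[OF assms(2)] fst_conv)


section \<open>The lower bound function and the safety region\<close>

text \<open>Only the component at \<open>c\<close> enters the minimization, and
  \<open>tests_component\<close> realizes every test as such a component. Thus classifiers can be
  replaced by scalar tests, translated so that \<open>x\<close> becomes the origin.\<close>

lemma lower_prob_eq_Least:
  fixes f :: "real ^ 'n \<Rightarrow> real ^ 'y"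
  assumes card: "CARD('y) \<ge> 2" and f: "f \<in> base_classifiers"
    and y0: "y0 = (f \<star> \<mu>) x $ c" and y1: "GDERIV (\<lambda>k. (f \<star> \<mu>) k $ c) x :> y1"
  shows "lower_prob \<mu> c y0 y1 x (x + \<delta>)
    = (LEAST v. \<exists>u\<in>tests lborel. moments u = moments (\<lambda>z. f (x + z) $ c) \<and> v = smooth1 u \<delta>)"
proof -
  let ?u = "\<lambda>z. f (x + z) $ c"
  have t: "(\<lambda>z. f z $ c) \<in> tests lborel" by (rule component_in_tests[OF f])
  have u: "?u \<in> tests lborel" by (rule tests_translate[OF t])
  have trans: "smooth1 (\<lambda>z. h z $ c) (x + k) = smooth1 (\<lambda>z. h (x + z) $ c) k"
    if "h \<in> base_classifiers" for h :: "real ^ 'n \<Rightarrow> real ^ 'y" and k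
    using tests_measurable[OF component_in_tests[OF that]] by (intro smooth1_translate) simp
  have "y0 = smooth1 ?u 0" using y0 trans[OF f, of 0] by (simp add: smooth_component[OF f])
  moreover have "y1 = (1 / \<sigma>\<^sup>2) *\<^sub>R (\<integral>z. ?u z *\<^sub>R (\<mu> z *\<^sub>R z) \<partial>lborel)"
    using GDERIV_unique[OF y1] GDERIV_smooth1[OF t, of x] by (simp add: smooth_component[OF f])
  ultimately have iff: "(h \<star> \<mu>) x $ c = y0 \<and> GDERIV (\<lambda>k. (h \<star> \<mu>) k $ c) x :> y1
      \<longleftrightarrow> moments (\<lambda>z. h (x + z) $ c) = moments ?u"
    if "h \<in> base_classifiers" for h :: "real ^ 'n \<Rightarrow> real ^ 'y"
    using that u by (intro local_information_iff_moments)
  have "(\<exists>h\<in>smoothed_classifiers \<mu>. h x $ c = y0 \<and> GDERIV (\<lambda>k. h k $ c) x :> y1 \<and> v = h (x + \<delta>) $ c)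
      \<longleftrightarrow> (\<exists>u\<in>tests lborel. moments u = moments ?u \<and> v = smooth1 u \<delta>)" (is "?L \<longleftrightarrow> ?R") for v
  proof
    assume ?L
    then obtain h where h: "h \<in> base_classifiers" "(h \<star> \<mu>) x $ c = y0"
      "GDERIV (\<lambda>k. (h \<star> \<mu>) k $ c) x :> y1" "v = (h \<star> \<mu>) (x + \<delta>) $ c"
      by (auto simp: smoothed_classifiers_def)
    then show ?R
      using iff[OF h(1)] tests_translate[OF component_in_tests[OF h(1)]] trans[OF h(1)]
      by (intro bexI[of _ "\<lambda>z. h (x + z) $ c"]) (auto simp: smooth_component)
  next
    assume ?R
    then obtain w where w: "w \<in> tests lborel" "moments w = moments ?u" "v = smooth1 w \<delta>" by blast
    obtain h :: "real ^ 'n \<Rightarrow> real ^ 'y" where h: "h \<in> base_classifiers" "\<And>z. h z $ c = w (- x + z)"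
      using tests_component[OF tests_translate[OF w(1), of "- x"] card] by metis
    then have "v = (h \<star> \<mu>) (x + \<delta>) $ c"
      using w(3) trans[OF h(1), of \<delta>] by (simp add: smooth_component)
    moreover have "moments (\<lambda>z. h (x + z) $ c) = moments ?u" using w(2) by (simp add: h(2))
    ultimately show ?L using iff[OF h(1)] h(1) by (auto simp: smoothed_classifiers_def)
  qed
  then show ?thesis unfolding lower_prob_def by simp
qed

text \<open>
  The minimal value at \<open>\<delta> = 0\<close> is \<open>y0\<close> for every admissible \<open>u\<close>, so there any of the convex
  minimizers for another displacement serves.
\<close>

lemma lower_prob_convex_minimizer:
  fixes f :: "real ^ 'n \<Rightarrow> real ^ 'y"
  assumes card: "CARD('y) \<ge> 2" and f: "f \<in> base_classifiers"
    and y0: "y0 = (f \<star> \<mu>) x $ c" and y1: "GDERIV (\<lambda>k. (f \<star> \<mu>) k $ c) x :> y1"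
  obtains C where "C \<in> sets borel" "convex C"
    "lower_prob \<mu> c y0 y1 x (x + \<delta>) = smooth1 (indicator C) \<delta>"
    "\<And>\<eta>. lower_prob \<mu> c y0 y1 x (x + \<eta>) \<le> smooth1 (indicator C) \<eta>"
proof -
  define u where "u = (\<lambda>z. f (x + z) $ c)"
  have u: "u \<in> tests lborel"
    unfolding u_def by (rule tests_translate[OF component_in_tests[OF f]])
  define p where "p \<eta> = lower_prob \<mu> c y0 y1 x (x + \<eta>)" for \<eta>
  define feasible where "feasible = {w \<in> tests lborel. moments w = moments u}"
  have p: "p \<eta> = smooth1 w \<eta>"
    if "w \<in> feasible" "\<And>v. v \<in> feasible \<Longrightarrow> smooth1 w \<eta> \<le> smooth1 v \<eta>" for w \<eta>
    unfolding p_def lower_prob_eq_Least[OF assms]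
    using that by (intro Least_equality) (auto simp: feasible_def u_def)
  have min: "\<exists>C. C \<in> sets borel \<and> convex C \<and> indicator C \<in> feasible \<and>
      (\<forall>v\<in>feasible. smooth1 (indicator C) \<eta> \<le> smooth1 v \<eta>)" if "\<eta> \<noteq> 0" for \<eta>
    using convex_minimizer[OF u that] indicator_in_tests[of _ lborel] unfolding feasible_def
    by (smt (verit) mem_Collect_eq sets_lborel)
  have zero: "smooth1 w 0 = smooth1 v 0" if "w \<in> feasible" "v \<in> feasible" for w v
    using that by (intro smooth1_zero_eq) (auto simp: feasible_def)
  have ex: "\<exists>C. C \<in> sets borel \<and> convex C \<and> indicator C \<in> feasible \<and>
      (\<forall>v\<in>feasible. smooth1 (indicator C) \<eta> \<le> smooth1 v \<eta>)" for \<eta>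
  proof (cases "\<eta> = 0")
    case True
    obtain d :: "real ^ 'n" where "d \<noteq> 0" by (metis axis_eq_0_iff zero_neq_one)
    from min[OF this] show ?thesis using zero True by (metis order_refl)
  qed (rule min)
  \<comment> \<open>A \<open>LEAST\<close> without an attained minimum bounds nothing, so this uses
    a minimizer at \<eta> itself, not only at \<delta>.\<close>
  have le: "p \<eta> \<le> smooth1 v \<eta>" if "v \<in> feasible" for v \<eta>
    using ex[of \<eta>] p that by metis
  from ex[of \<delta>] obtain C where C: "C \<in> sets borel" "convex C" "indicator C \<in> feasible"
    "\<And>v. v \<in> feasible \<Longrightarrow> smooth1 (indicator C) \<delta> \<le> smooth1 v \<delta>" by blast
  show thesis
    using that[OF C(1,2)] p[OF C(3,4)] le[OF C(3)] by (simp add: p_def)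
qed

lemma convex_safety_region:
  fixes f :: "real ^ 'n \<Rightarrow> real ^ 'y"
  assumes "CARD('y) \<ge> 2" "f \<in> base_classifiers"
    "y0 = (f \<star> \<mu>) x $ c" "GDERIV (\<lambda>k. (f \<star> \<mu>) k $ c) x :> y1"
  shows "convex (safety_region \<mu> c y0 y1 x)"
proof (rule convexI)
  let ?p = "\<lambda>\<eta>. lower_prob \<mu> c y0 y1 x (x + \<eta>)"
  fix j k and s t :: real
  assume jk: "j \<in> safety_region \<mu> c y0 y1 x" "k \<in> safety_region \<mu> c y0 y1 x"
    and st: "0 \<le> s" "0 \<le> t" "s + t = 1"
  obtain C where C: "C \<in> sets borel" "convex C"
    "?p (s *\<^sub>R j + t *\<^sub>R k) = smooth1 (indicator C) (s *\<^sub>R j + t *\<^sub>R k)"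
    "\<And>\<eta>. ?p \<eta> \<le> smooth1 (indicator C) \<eta>"
    using lower_prob_convex_minimizer[OF assms, of "s *\<^sub>R j + t *\<^sub>R k"] by metis
  \<comment> \<open>The region is given by a strict inequality, while superlevel sets are taken
    non-strictly. The level \<open>m\<close>, already above 1/2, preserves strictness.\<close>
  define m where "m = min (?p j) (?p k)"
  have m: "1 / 2 < m" using jk by (simp add: m_def safety_region_def)
  have "m \<le> smooth1 (indicator C) j" "m \<le> smooth1 (indicator C) k"
    using C(4)[of j] C(4)[of k] by (auto simp: m_def)
  then have "s *\<^sub>R j + t *\<^sub>R k \<in> {\<eta>. m \<le> smooth1 (indicator C) \<eta>}"
    using m by (intro convexD[OF convex_smooth1_indicator_superlevel[OF C(1,2)] _ _ st]) auto
  then show "s *\<^sub>R j + t *\<^sub>R k \<in> safety_region \<mu> c y0 y1 x"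
    using m C(3) by (simp add: safety_region_def)
qed

end

theorem proposition1:
  fixes \<sigma> :: real
    and \<mu> :: "real ^ 'n \<Rightarrow> real"
    and f g :: "real ^ 'n \<Rightarrow> real ^ 'y"
    and x y1 :: "real ^ 'n"
    and y0 :: real
    and c :: 'y
  assumes "CARD('y) \<ge> 2"
    and "\<sigma> > 0"
    and "\<mu> = gaussian_density \<sigma>"
    and "f \<in> base_classifiers"
    and "g = f \<star> \<mu>"
    and "y0 = g x $ c"
    and "GDERIV (\<lambda>u. g u $ c) x :> y1"
  shows "convex (safety_region \<mu> c y0 y1 x) \<and>
    (\<forall>x1\<in>safety_region \<mu> c y0 y1 x. \<forall>x2\<in>safety_region \<mu> c y0 y1 x.
       (x1 + x2) /\<^sub>R 2 \<in> safety_region \<mu> c y0 y1 x)"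
proof -
  interpret gaussian \<sigma> \<mu> by (rule gaussian.intro[OF assms(2,3)])
  have conv: "convex (safety_region \<mu> c y0 y1 x)"
    using assms by (intro convex_safety_region[of f]) auto
  have "(x1 + x2) /\<^sub>R 2 \<in> safety_region \<mu> c y0 y1 x"
    if "x1 \<in> safety_region \<mu> c y0 y1 x" "x2 \<in> safety_region \<mu> c y0 y1 x" for x1 x2
    using convexD[OF conv that, of "1 / 2" "1 / 2"] by (simp add: scaleR_add_right)
  with conv show ?thesis by blast
qed

end
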